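(* Suppose that Conjecture (PP) stated in the context holds. Let $T$ be a locally finite simplicial tree. Then a finitely generated subgroup of $\mathrm{Isom}(T)$ is both discrete and free if and only if it contains no non-trivial elliptic element.
   Context: Let $T$ be a simplicial tree with vertex set $V(T)$ and standard path metric $d$ (each edge has length $1$); $T$ is identified with its geometric realization. Every isometry considered is assumed to act on $T$ without inversions (this can be arranged by subdividing edges). The translation length of an isometry $g$ is $l(g)=\min_{x\in V(T)}d(x,gx)$. If $l(g)=0$, $g$ is elliptic (it fixes a vertex). If $l(g)>0$, $g$ is hyperbolic, and its axis is the bi-infinite path in $T$ on which $g$ acts by translations of length $l(g)$. The isometry group $\mathrm{Isom}(T)$ carries the topology of pointwise convergence; a subgroup is discrete if its subspace topology is the discrete topology. For an $n$-tuple $X=(g_1,\dots,g_n)$ of isometries of a simplicial tree define $$L(X)=\sum_{1\le i\le n} l(g_i)+\sum_{1\le i<j\le n}\bigl(l(g_ig_j)+l(g_ig_j^{-1})\bigr).$$ For $j\in\{1,\dots,n\}$ and subsets $S_1,S_2\subseteq\{1,\dots,n\}\setminus\{j\}$, let $X^{j}_{S_1,S_2}$ be the $n$-tuple obtained from $X$ by leaving $g_j$ unchanged and, for $i\ne j$, replacing $g_i$ by: $g_jg_i$ if $i\in S_1\setminus S_2$; $g_ig_j^{-1}$ if $i\in S_2\setminus S_1$; $g_jg_ig_j^{-1}$ if $i\in S_1\cap S_2$; $g_i$ otherwise. The tuple $X$ is minimal if $L(X)\le L(X^{j}_{S_1,S_2})$ for every $j\in\{1,\dots,n\}$ and all $S_1,S_2\subseteq\{1,\dots,n\}\setminus\{j\}$.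 For hyperbolic $g_i,g_j$ with axes $\gamma_i,\gamma_j$, the projection of $\gamma_j$ onto $\gamma_i$ is $\mathrm{Proj}_{\gamma_i}(\gamma_j)=\{x\in\gamma_i: d(x,\gamma_j)=d(\gamma_i,\gamma_j)\}$; it is the unique vertex of $\gamma_i$ closest to $\gamma_j$ if $\gamma_i\cap\gamma_j=\varnothing$, and equals $\gamma_i\cap\gamma_j$ otherwise. An $n$-tuple $X=(g_1,\dots,g_n)$ satisfies the hypotheses of the Ping Pong Lemma if all $g_i$ are hyperbolic, with axes $\gamma_1,\dots,\gamma_n$, and for each $1\le i\le n$ there is an open segment $P_i\subseteq\gamma_i$ of length $l(g_i)$ (endpoints not required to be vertices) such that $\bigcup_{j\neq i}\mathrm{Proj}_{\gamma_i}(\gamma_j)\subseteq P_i$. Conjecture (PP): for every $n$ and every $n$-tuple $X=(g_1,\dots,g_n)$ of isometries of a simplicial tree, if $X$ is minimal then either some $g_i$ is elliptic, or $X$ satisfies the hypotheses of the Ping Pong Lemma. *)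

theory Defs
  imports "HOL-Analysis.Analysis" "HOL-Algebra.Bij" "HOL-Algebra.Generated_Groups"
begin

section \<open>Simplicial trees\<close>

record 'a sgraph =
  verts :: "'a set"
  edges :: "'a set set"

definition walk :: "'a sgraph \<Rightarrow> 'a \<Rightarrow> 'a list \<Rightarrow> 'a \<Rightarrow> bool" where
  "walk T x p y \<longleftrightarrow> p \<noteq> [] \<and> hd p = x \<and> last p = y \<and> set p \<subseteq> verts T \<and>
     successively (\<lambda>u v. {u, v} \<in> edges T) p"

definition circuit :: "'a sgraph \<Rightarrow> 'a list \<Rightarrow> bool" where
  "circuit T p \<longleftrightarrow> length p \<ge> 3 \<and> distinct p \<and> set p \<subseteq> verts T \<and>
     successively (\<lambda>u v. {u, v} \<in> edges T) p \<and> {last p, hd p} \<in> edges T"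

definition simplicial_tree :: "'a sgraph \<Rightarrow> bool" where
  "simplicial_tree T \<longleftrightarrow>
     verts T \<noteq> {} \<and>
     (\<forall>e\<in>edges T. e \<subseteq> verts T \<and> card e = 2) \<and>
     (\<forall>x\<in>verts T. \<forall>y\<in>verts T. \<exists>p. walk T x p y) \<and>
     (\<nexists>p. circuit T p)"

definition locally_finite_graph :: "'a sgraph \<Rightarrow> bool" where
  "locally_finite_graph T \<longleftrightarrow> (\<forall>v\<in>verts T. finite {e \<in> edges T. v \<in> e})"

definition gdist :: "'a sgraph \<Rightarrow> 'a \<Rightarrow> 'a \<Rightarrow> nat" where
  "gdist T x y = (LEAST n. \<exists>p. walk T x p y \<and> length p = Suc n)"

subsection \<open>Geometric realization\<close>

text \<open>A point of the realization is given by its barycentric coordinates: a nonnegative weight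
  function of total weight 1 whose support is a vertex or an edge.\<close>

definition supp :: "('a \<Rightarrow> real) \<Rightarrow> 'a set" where
  "supp p = {v. p v \<noteq> 0}"

definition realization :: "'a sgraph \<Rightarrow> ('a \<Rightarrow> real) set" where
  "realization T = {p. (\<forall>v. 0 \<le> p v) \<and> ((\<exists>v\<in>verts T. supp p = {v}) \<or> supp p \<in> edges T) \<and>
     (\<Sum>v\<in>supp p. p v) = 1}"

text \<open>The path metric with edges of length 1. On a common closed edge with ends \<open>u\<close>, \<open>v\<close> it is
  \<open>\<bar>p u - q u\<bar> = \<bar>p v - q v\<bar>\<close>, which is half the sum below; otherwise a shortest path leaves the
  edge of \<open>p\<close> at an end \<open>a\<close>, at distance \<open>1 - p a\<close>, and enters that of \<open>q\<close> at an end \<open>b\<close>.\<close>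

definition rdist :: "'a sgraph \<Rightarrow> ('a \<Rightarrow> real) \<Rightarrow> ('a \<Rightarrow> real) \<Rightarrow> real" where
  "rdist T p q =
     (if (\<exists>v\<in>verts T. supp p \<union> supp q = {v}) \<or> (\<exists>e\<in>edges T. supp p \<union> supp q \<subseteq> e)
      then (\<Sum>v\<in>supp p \<union> supp q. \<bar>p v - q v\<bar>) / 2
      else Min {(1 - p a) + real (gdist T a b) + (1 - q b) | a b. a \<in> supp p \<and> b \<in> supp q})"

definition rdist_point_set :: "'a sgraph \<Rightarrow> ('a \<Rightarrow> real) \<Rightarrow> ('a \<Rightarrow> real) set \<Rightarrow> real" where
  "rdist_point_set T x B = (INF b\<in>B. rdist T x b)"

definition rdist_sets :: "'a sgraph \<Rightarrow> ('a \<Rightarrow> real) set \<Rightarrow> ('a \<Rightarrow> real) set \<Rightarrow> real" where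
  "rdist_sets T A B = (INF a\<in>A. rdist_point_set T a B)"

text \<open>Geodesics in a tree are unique, so the open segment from \<open>p\<close> to \<open>q\<close> is the set of
  points strictly between \<open>p\<close> and \<open>q\<close> in the metric sense.\<close>

definition osegment :: "'a sgraph \<Rightarrow> ('a \<Rightarrow> real) \<Rightarrow> ('a \<Rightarrow> real) \<Rightarrow> ('a \<Rightarrow> real) set" where
  "osegment T p q = {x \<in> realization T.
     rdist T p x + rdist T x q = rdist T p q \<and> x \<noteq> p \<and> x \<noteq> q}"

definition bi_infinite_path :: "'a sgraph \<Rightarrow> (int \<Rightarrow> 'a) \<Rightarrow> bool" where
  "bi_infinite_path T c \<longleftrightarrow> range c \<subseteq> verts T \<and> inj c \<and> (\<forall>k. {c k, c (k + 1)} \<in> edges T)"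

definition path_points :: "'a sgraph \<Rightarrow> (int \<Rightarrow> 'a) \<Rightarrow> ('a \<Rightarrow> real) set" where
  "path_points T c = {p \<in> realization T. \<exists>k. supp p \<subseteq> {c k, c (k + 1)}}"


section \<open>Isometries\<close>

text \<open>Isometries of \<open>T\<close> are represented by their action on the vertices (extended by
  \<open>undefined\<close> outside \<open>verts T\<close>, as in \<^const>\<open>BijGroup\<close>); they act affinely on edges.\<close>

definition Isom :: "'a sgraph \<Rightarrow> ('a \<Rightarrow> 'a) monoid" where
  "Isom T = BijGroup (verts T)
     \<lparr>carrier := {g \<in> Bij (verts T). \<forall>x\<in>verts T. \<forall>y\<in>verts T. gdist T (g x) (g y) = gdist T x y}\<rparr>"

definition is_inversion :: "'a sgraph \<Rightarrow> ('a \<Rightarrow> 'a) \<Rightarrow> bool" where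
  "is_inversion T g \<longleftrightarrow> (\<exists>u v. {u, v} \<in> edges T \<and> g u = v \<and> g v = u)"

definition acts_without_inversions :: "'a sgraph \<Rightarrow> ('a \<Rightarrow> 'a) set \<Rightarrow> bool" where
  "acts_without_inversions T G \<longleftrightarrow> (\<forall>g\<in>G. \<not> is_inversion T g)"

definition tlen :: "'a sgraph \<Rightarrow> ('a \<Rightarrow> 'a) \<Rightarrow> nat" where
  "tlen T g = (INF x\<in>verts T. gdist T x (g x))"

definition elliptic :: "'a sgraph \<Rightarrow> ('a \<Rightarrow> 'a) \<Rightarrow> bool" where
  "elliptic T g \<longleftrightarrow> tlen T g = 0"

definition hyperbolic :: "'a sgraph \<Rightarrow> ('a \<Rightarrow> 'a) \<Rightarrow> bool" where
  "hyperbolic T g \<longleftrightarrow> tlen T g > 0"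

text \<open>As a subset of the realization; meaningful for hyperbolic \<open>g\<close> acting without inversions.\<close>

definition axis :: "'a sgraph \<Rightarrow> ('a \<Rightarrow> 'a) \<Rightarrow> ('a \<Rightarrow> real) set" where
  "axis T g = (THE A. \<exists>c. bi_infinite_path T c \<and> (\<forall>k. g (c k) = c (k + int (tlen T g))) \<and>
     A = path_points T c)"

text \<open>The projection of \<open>B\<close> onto \<open>A\<close>.\<close>

definition Proj :: "'a sgraph \<Rightarrow> ('a \<Rightarrow> real) set \<Rightarrow> ('a \<Rightarrow> real) set \<Rightarrow> ('a \<Rightarrow> real) set" where
  "Proj T A B = {x \<in> A. rdist_point_set T x B = rdist_sets T A B}"

text \<open>Pointwise convergence on the vertices, which is the same as on all of the realization.\<close>

definition isom_topology :: "'a sgraph \<Rightarrow> ('a \<Rightarrow> 'a) topology" where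
  "isom_topology T = subtopology
     (product_topology (\<lambda>_. Metric_space.mtopology (verts T) (\<lambda>x y. real (gdist T x y))) (verts T))
     (carrier (Isom T))"

definition discrete_subgroup :: "'a sgraph \<Rightarrow> ('a \<Rightarrow> 'a) set \<Rightarrow> bool" where
  "discrete_subgroup T G \<longleftrightarrow> subtopology (isom_topology T) G = discrete_topology G"


section \<open>Finitely generated and free groups\<close>

definition fin_gen :: "('g, 'm) monoid_scheme \<Rightarrow> bool" where
  "fin_gen H \<longleftrightarrow> (\<exists>S. finite S \<and> S \<subseteq> carrier H \<and> generate H S = carrier H)"

text \<open>Words over an alphabet \<open>S\<close>: the letter \<open>(True, s)\<close> stands for \<open>s\<close> and \<open>(False, s)\<close> for its
  formal inverse. The reduced words form the free group on \<open>S\<close>, so a group is free on \<open>S\<close> if and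
  only if each of its elements is the value of exactly one reduced word.\<close>

definition reduced_words :: "'g set \<Rightarrow> (bool \<times> 'g) list set" where
  "reduced_words S = {w. snd ` set w \<subseteq> S \<and>
     successively (\<lambda>x y. \<not> (snd x = snd y \<and> fst x \<noteq> fst y)) w}"

definition eval_word :: "('g, 'm) monoid_scheme \<Rightarrow> (bool \<times> 'g) list \<Rightarrow> 'g" where
  "eval_word H w =
     foldr (\<lambda>(b, s) h. (if b then s else inv\<^bsub>H\<^esub> s) \<otimes>\<^bsub>H\<^esub> h) w \<one>\<^bsub>H\<^esub>"

definition free_group :: "('g, 'm) monoid_scheme \<Rightarrow> bool" where
  "free_group H \<longleftrightarrow> (\<exists>S\<subseteq>carrier H. bij_betw (eval_word H) (reduced_words S) (carrier H))"


section \<open>Minimal tuples and the Ping Pong conjecture\<close>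

text \<open>An \<open>n\<close>-tuple is a function on \<open>nat\<close> of which only the values at \<open>{1..n}\<close> are used.\<close>

definition Lsum :: "'a sgraph \<Rightarrow> nat \<Rightarrow> (nat \<Rightarrow> 'a \<Rightarrow> 'a) \<Rightarrow> nat" where
  "Lsum T n X = (\<Sum>i\<in>{1..n}. tlen T (X i)) +
     (\<Sum>(i, j)\<in>{(i, j). 1 \<le> i \<and> i < j \<and> j \<le> n}.
        tlen T (X i \<otimes>\<^bsub>Isom T\<^esub> X j) + tlen T (X i \<otimes>\<^bsub>Isom T\<^esub> inv\<^bsub>Isom T\<^esub> (X j)))"

definition tuple_move ::
  "'a sgraph \<Rightarrow> nat \<Rightarrow> nat set \<Rightarrow> nat set \<Rightarrow> (nat \<Rightarrow> 'a \<Rightarrow> 'a) \<Rightarrow> nat \<Rightarrow> 'a \<Rightarrow> 'a" where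
  "tuple_move T j S1 S2 X i =
     (if i = j then X j
      else if i \<in> S1 - S2 then X j \<otimes>\<^bsub>Isom T\<^esub> X i
      else if i \<in> S2 - S1 then X i \<otimes>\<^bsub>Isom T\<^esub> inv\<^bsub>Isom T\<^esub> (X j)
      else if i \<in> S1 \<inter> S2 then X j \<otimes>\<^bsub>Isom T\<^esub> X i \<otimes>\<^bsub>Isom T\<^esub> inv\<^bsub>Isom T\<^esub> (X j)
      else X i)"

definition minimal_tuple :: "'a sgraph \<Rightarrow> nat \<Rightarrow> (nat \<Rightarrow> 'a \<Rightarrow> 'a) \<Rightarrow> bool" where
  "minimal_tuple T n X \<longleftrightarrow>
     (\<forall>j\<in>{1..n}. \<forall>S1 S2. S1 \<subseteq> {1..n} - {j} \<longrightarrow> S2 \<subseteq> {1..n} - {j} \<longrightarrow>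
        Lsum T n X \<le> Lsum T n (tuple_move T j S1 S2 X))"

definition ping_pong_hypotheses :: "'a sgraph \<Rightarrow> nat \<Rightarrow> (nat \<Rightarrow> 'a \<Rightarrow> 'a) \<Rightarrow> bool" where
  "ping_pong_hypotheses T n X \<longleftrightarrow>
     (\<forall>i\<in>{1..n}. hyperbolic T (X i)) \<and>
     (\<forall>i\<in>{1..n}. \<exists>p\<in>axis T (X i). \<exists>q\<in>axis T (X i).
        osegment T p q \<subseteq> axis T (X i) \<and> rdist T p q = real (tlen T (X i)) \<and>
        (\<Union>j\<in>{1..n} - {i}. Proj T (axis T (X i)) (axis T (X j))) \<subseteq> osegment T p q)"

text \<open>All isometries occurring here, i.e. all elements of the group generated by \<open>X\<close>, are assumed
  to act without inversions. The statement ranges over all trees with vertices in \<open>'a\<close>.\<close>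

definition conjecture_PP :: "'a itself \<Rightarrow> bool" where
  "conjecture_PP (_ :: 'a itself) \<longleftrightarrow>
     (\<forall>(T :: 'a sgraph) n X.
        simplicial_tree T \<longrightarrow> (\<forall>i\<in>{1..n}. X i \<in> carrier (Isom T)) \<longrightarrow>
        acts_without_inversions T (generate (Isom T) (X ` {1..n})) \<longrightarrow>
        minimal_tuple T n X \<longrightarrow>
        (\<exists>i\<in>{1..n}. elliptic T (X i)) \<or> ping_pong_hypotheses T n X)"

end

theory Submission
  imports Defs
begin

text \<open>
  Suppose that \<open>G\<close> is discrete and free and that \<open>g \<in> G\<close> fixes a vertex \<open>x\<close>. Discreteness
  provides a finite set \<open>F\<close> of vertices such that only the identity of \<open>G\<close> fixes \<open>F\<close> pointwise.
  The powers of \<open>g\<close> map \<open>F\<close> into a ball around \<open>x\<close>, which is finite by local finiteness, so two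
  of them agree on \<open>F\<close> and \<open>g\<close> has finite order (\<open>discrete_elliptic_torsion\<close>). A free group is
  torsion-free (\<open>free_group_torsion_free\<close>), hence \<open>g\<close> is trivial.

  Conversely, suppose that no non-trivial element of \<open>G\<close> fixes a vertex. Evaluating at one vertex
  already separates the elements of \<open>G\<close>, so \<open>G\<close> is discrete (\<open>discrete_subgroup_iff\<close>). For
  freeness, take a generating tuple of least length and, among the tuples of this length, one with
  the least value of \<open>L\<close>. The moves in the definition of minimality do not change the generated
  subgroup, so this tuple is minimal; and none of its entries is trivial, as a trivial entry could
  be dropped (\<open>minimal_generating_tuple\<close>). Therefore no entry is elliptic, and the conjecture
  yields the hypotheses of the Ping Pong Lemma.

  These hypotheses imply freeness as follows (\<open>free_if_ping_pong\<close>). Write \<open>\<gamma>\<^sub>i\<close> for the axis of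
  \<open>g\<^sub>i\<close>, parametrised by the integers, and locate a vertex by the parameter of its nearest-point
  projection onto \<open>\<gamma>\<^sub>i\<close>. The open segment \<open>P\<^sub>i\<close> becomes a window of \<open>l(g\<^sub>i)\<close> consecutive integers
  that contains the projections of all other axes (\<open>ping_pong_windows\<close>). Since \<open>g\<^sub>i\<close> shifts the
  parameter by \<open>l(g\<^sub>i)\<close>, it sends every vertex that does not lie below the window to a vertex
  above it, and the inverse of \<open>g\<^sub>i\<close> does the opposite. So the sets of vertices above and below
  the windows play ping-pong as soon as those belonging to different axes are disjoint. This
  disjointness is the geometric core (\<open>projections_nearest\<close>): for two axes \<open>\<gamma>\<^sub>i\<close>, \<open>\<gamma>\<^sub>j\<close> and a
  vertex \<open>v\<close>, either the projection of \<open>v\<close> onto \<open>\<gamma>\<^sub>i\<close> lies in the projection of \<open>\<gamma>\<^sub>j\<close>, or the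
  same holds with \<open>i\<close> and \<open>j\<close> exchanged.

  All the geometry of trees used here is deduced from the four-point condition \<open>four_point\<close>, which
  says that a tree is 0-hyperbolic, and from the fact that a neighbour one step closer to a given
  root is unique (\<open>parent_unique\<close>).
\<close>

section \<open>The four-point condition\<close>

locale tree =
  fixes T :: "'a sgraph"
  assumes simplicial: "simplicial_tree T"
begin

abbreviation V :: "'a set" where "V \<equiv> verts T"
abbreviation adj :: "'a \<Rightarrow> 'a \<Rightarrow> bool" where "adj u v \<equiv> {u, v} \<in> edges T"
text \<open>Distances are taken in \<open>int\<close> so that they can be subtracted and compared with
  differences of parameters of a line.\<close>
abbreviation d :: "'a \<Rightarrow> 'a \<Rightarrow> int" where "d x y \<equiv> int (gdist T x y)"

lemma adj_sym: "adj u v \<Longrightarrow> adj v u"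
  by (simp add: insert_commute)

lemma adjD:
  assumes "adj u v"
  shows "u \<in> V" "v \<in> V" "u \<noteq> v"
proof -
  have "{u, v} \<subseteq> V \<and> card {u, v} = 2"
    using assms simplicial unfolding simplicial_tree_def by blast
  then show "u \<in> V" "v \<in> V" "u \<noteq> v" by auto
qed

lemma walk_snoc: "walk T x p y \<Longrightarrow> adj y z \<Longrightarrow> walk T x (p @ [z]) z"
  using adjD(2) by (auto simp: walk_def successively_append_iff)

lemma walk_rev:
  assumes "walk T x p y" shows "walk T y (rev p) x"
proof -
  have "successively (\<lambda>u v. adj v u) p = successively adj p"
    by (rule successively_cong) (auto simp: insert_commute)
  then show ?thesis using assms by (auto simp: walk_def hd_rev last_rev)
qed

lemma gdist_walk:
  assumes "x \<in> V" "y \<in> V"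
  obtains p where "walk T x p y" "length p = Suc (gdist T x y)"
proof -
  obtain p where p: "walk T x p y"
    using assms simplicial unfolding simplicial_tree_def by blast
  then have "length p = Suc (length p - 1)" by (auto simp: walk_def)
  with p have "\<exists>n p. walk T x p y \<and> length p = Suc n" by blast
  from LeastI_ex[OF this] show ?thesis using that by (auto simp: gdist_def)
qed

lemma gdist_le:
  assumes "walk T x p y" "length p = Suc n"
  shows "gdist T x y \<le> n"
  unfolding gdist_def by (rule Least_le) (use assms in blast)

lemma gdist_refl [simp]: "x \<in> V \<Longrightarrow> gdist T x x = 0"
  using gdist_le[of x "[x]" x 0] by (auto simp: walk_def)

lemma gdist_eq_0:
  assumes "x \<in> V" "y \<in> V"
  shows "gdist T x y = 0 \<longleftrightarrow> x = y"
proof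
  assume z: "gdist T x y = 0"
  obtain p where "walk T x p y" "length p = Suc (gdist T x y)"
    using gdist_walk assms by blast
  then show "x = y" using z by (auto simp: walk_def length_Suc_conv)
qed (use assms in auto)

lemma gdist_commute: "gdist T x y = gdist T y x"
proof -
  have "(\<exists>p. walk T x p y \<and> length p = Suc n) \<longleftrightarrow> (\<exists>p. walk T y p x \<and> length p = Suc n)" for n
    using walk_rev[of x _ y] walk_rev[of y _ x] by (metis length_rev)
  then show ?thesis by (simp add: gdist_def)
qed

lemma gdist_step:
  assumes "x \<in> V" "adj y z"
  shows "gdist T x z \<le> Suc (gdist T x y)"
proof -
  obtain p where "walk T x p y" "length p = Suc (gdist T x y)"
    using gdist_walk assms adjD by blast
  then show ?thesis using gdist_le[OF walk_snoc[OF _ assms(2)]] by simp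
qed

lemma gdist_pred:
  assumes "x \<in> V" "z \<in> V" "gdist T x z = Suc n"
  obtains y where "adj y z" "gdist T x y = n"
proof -
  obtain p where p: "walk T x p z" "length p = Suc (Suc n)"
    using gdist_walk assms by metis
  define q where "q = butlast p"
  have pq: "p = q @ [z]" using p by (auto simp: q_def walk_def)
  have q: "q \<noteq> []" "length q = Suc n" using p(2) pq by auto
  have a: "adj (last q) z" and w: "walk T x q (last q)"
    using p(1) q(1) by (auto simp: walk_def pq successively_append_iff)
  have "gdist T x (last q) \<le> n" using gdist_le[OF w q(2)] .
  moreover have "Suc n \<le> Suc (gdist T x (last q))" using gdist_step[OF assms(1) a] assms(3) by simp
  ultimately show ?thesis using that[OF a] by simp
qed

lemma gdist_triangle:
  assumes "x \<in> V" "y \<in> V" "z \<in> V"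
  shows "gdist T x z \<le> gdist T x y + gdist T y z"
  using assms(3)
proof (induction "gdist T y z" arbitrary: z)
  case 0
  then show ?case using gdist_eq_0 assms by auto
next
  case (Suc n)
  obtain u where u: "adj u z" "gdist T y u = n"
    using gdist_pred[OF assms(2) Suc.prems Suc.hyps(2)[symmetric]] by blast
  have "gdist T x u \<le> gdist T x y + gdist T y u" using Suc u adjD by blast
  then show ?case using gdist_step[OF assms(1) u(1)] Suc.hyps(2) u by simp
qed

lemma adj_iff:
  assumes "u \<in> V" "v \<in> V"
  shows "adj u v \<longleftrightarrow> gdist T u v = 1"
proof
  assume a: "adj u v"
  have "gdist T u v \<le> 1" using gdist_step[OF assms(1) a] assms by simp
  moreover have "gdist T u v \<noteq> 0" using adjD(3)[OF a] gdist_eq_0 assms by simp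
  ultimately show "gdist T u v = 1" by simp
next
  assume "gdist T u v = 1"
  then obtain y where "adj y v" "gdist T u y = 0" using gdist_pred[OF assms] by (metis One_nat_def)
  then show "adj u v" using gdist_eq_0 assms adjD by metis
qed

lemma shortcut_walk:
  assumes "walk T a p b"
  shows "\<exists>q. walk T a q b \<and> distinct q \<and> set q \<subseteq> set p"
  using assms
proof (induction "length p" arbitrary: p rule: less_induct)
  case less
  show ?case
  proof (cases "distinct p")
    case True
    then show ?thesis using less by blast
  next
    case False
    then obtain xs ys zs u where p: "p = xs @ [u] @ ys @ [u] @ zs"
      using not_distinct_decomp by blast
    let ?q = "xs @ [u] @ zs"
    have "walk T a ?q b" using less.prems unfolding p walk_def
      by (auto simp: successively_append_iff successively_Cons hd_append last_append split: if_splits)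
    moreover have "length ?q < length p" "set ?q \<subseteq> set p" using p by auto
    ultimately show ?thesis using less.hyps by (meson order_trans)
  qed
qed

text \<open>Otherwise a simple path from \<open>a\<close> to \<open>b\<close> that avoids \<open>v\<close> would close up through \<open>v\<close>
  to a circuit. This is the only place where the absence of circuits enters.\<close>
lemma walk_to_neighbour_passes:
  assumes "adj a v" "adj b v" "walk T a p b" "v \<notin> set p"
  shows "a = b"
proof (rule ccontr)
  assume ne: "a \<noteq> b"
  obtain q where q: "walk T a q b" "distinct q" "set q \<subseteq> set p"
    using shortcut_walk assms(3) by blast
  have "length q \<ge> 2" using q(1) ne
    by (cases q; cases "tl q") (auto simp: walk_def)
  then have "circuit T (q @ [v])"
    using q assms adjD(2)[OF assms(1)]
    by (auto simp: circuit_def walk_def successively_append_iff insert_commute)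
  then show False using simplicial unfolding simplicial_tree_def by blast
qed

text \<open>A geodesic from \<open>r\<close> to \<open>x\<close> works: all its vertices before \<open>x\<close> are closer to \<open>r\<close> than
  \<open>v\<close> is.\<close>
lemma walk_avoiding:
  assumes "r \<in> V" "v \<in> V" "x \<in> V" "x \<noteq> v" "gdist T r x \<le> gdist T r v"
  shows "\<exists>p. walk T r p x \<and> v \<notin> set p"
  using assms(3-)
proof (induction "gdist T r x" arbitrary: x)
  case 0
  then have "r = x" using gdist_eq_0 assms(1) by metis
  then have "walk T r [x] x \<and> v \<notin> set [x]" using 0 by (auto simp: walk_def)
  then show ?case by blast
next
  case (Suc n)
  obtain u where u: "adj u x" "gdist T r u = n"
    using gdist_pred[OF assms(1) Suc.prems(1) Suc.hyps(2)[symmetric]] by blast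
  then have "u \<noteq> v" using Suc by auto
  then obtain p where "walk T r p u" "v \<notin> set p"
    using Suc.hyps(1)[of u] u Suc.prems Suc.hyps(2) adjD(1) by auto
  then have "walk T r (p @ [x]) x \<and> v \<notin> set (p @ [x])" using walk_snoc u Suc.prems by auto
  then show ?case by blast
qed

lemma walk_append:
  assumes "walk T x p y" "walk T y q z"
  shows "walk T x (p @ tl q) z"
proof -
  obtain q' where "q = y # q'" using assms(2) by (cases q) (auto simp: walk_def)
  then show ?thesis using assms
    by (auto simp: walk_def successively_append_iff successively_Cons last_append)
qed

text \<open>Two such neighbours of \<open>v\<close> could be joined through \<open>r\<close> without passing \<open>v\<close>. Equality
  of distances is included in the hypothesis, which is what rules out, in \<open>adj_dist\<close>, edges
  whose ends are equally far from \<open>r\<close>.\<close>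
lemma parent_unique:
  assumes r: "r \<in> V" and ab: "adj a v" "adj b v"
    and le: "gdist T r a \<le> gdist T r v" "gdist T r b \<le> gdist T r v"
  shows "a = b"
proof -
  obtain p where p: "walk T r p a" "v \<notin> set p"
    using walk_avoiding[OF r _ _ _ le(1)] adjD[OF ab(1)] by blast
  obtain q where q: "walk T r q b" "v \<notin> set q"
    using walk_avoiding[OF r _ _ _ le(2)] adjD[OF ab(2)] by blast
  have "v \<notin> set (rev p @ tl q)" using p q by (auto dest: list.set_sel(2)[rotated])
    (metis list.sel(2) list.set_sel(2))
  then show ?thesis
    using walk_to_neighbour_passes[OF ab walk_append[OF walk_rev[OF p(1)] q(1)]] by blast
qed

lemma adj_dist:
  assumes r: "r \<in> V" and uv: "adj u v"
  shows "d r v = d r u + 1 \<or> d r v = d r u - 1"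
proof -
  have "gdist T r v \<noteq> gdist T r u"
  proof
    assume eq: "gdist T r v = gdist T r u"
    show False
    proof (cases "gdist T r v")
      case 0
      then show False using eq gdist_eq_0 r adjD[OF uv] by metis
    next
      case (Suc n)
      then obtain a where "adj a v" "gdist T r a = n" using gdist_pred r adjD[OF uv] by metis
      then show False using parent_unique[OF r _ uv, of a] Suc eq by auto
    qed
  qed
  then show ?thesis
    using gdist_step[OF r uv] gdist_step[OF r adj_sym[OF uv]] by linarith
qed

text \<open>Removing the edge separates \<open>x\<close> from \<open>y\<close>, so the geodesic between them crosses it.
  The induction pushes the edge towards \<open>y\<close>: as the neighbour \<open>w\<close> of \<open>w'\<close> is the unique one
  closer to \<open>x\<close>, the next vertex on the way to \<open>y\<close> is farther from \<open>x\<close>.\<close>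
lemma separating_edge:
  assumes "x \<in> V" "y \<in> V" "adj w w'" "d x w = d x w' - 1" "d y w = d y w' + 1"
  shows "d x y = d x w' + d y w'"
  using assms(3-)
proof (induction "gdist T y w'" arbitrary: w w')
  case 0
  then have "y = w'" using gdist_eq_0 assms(2) adjD by metis
  then show ?case using assms by simp
next
  case (Suc n)
  obtain u where u: "adj u w'" "gdist T y u = n"
    using gdist_pred[OF assms(2) adjD(2)[OF Suc.prems(1)] Suc.hyps(2)[symmetric]] by blast
  have "d x u = d x w' + 1"
  proof (rule ccontr)
    assume "d x u \<noteq> d x w' + 1"
    then have "d x u = d x w' - 1" using adj_dist[OF assms(1) u(1)] by linarith
    then have "u = w" using parent_unique[OF assms(1) u(1) Suc.prems(1)] Suc.prems by auto
    then show False using Suc u by auto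
  qed
  then show ?case
    using Suc.hyps(1)[of u w'] adj_sym[OF u(1)] u Suc.hyps(2) Suc.prems by simp
qed

lemma d_triangle: "x \<in> V \<Longrightarrow> y \<in> V \<Longrightarrow> z \<in> V \<Longrightarrow> d x z \<le> d x y + d y z"
  using gdist_triangle[of x y z] by linarith

text \<open>Among the three ways of splitting four points into two pairs, the two largest sums
  of distances agree. The induction moves \<open>w\<close> away from \<open>z\<close> along an edge. If \<open>w\<close> moves away
  from both \<open>x\<close> and \<open>y\<close>, all three sums grow by one; if it moves towards one of them,
  \<open>separating_edge\<close> determines the distance from that vertex to every vertex on the other side
  of the edge.\<close>
proposition four_point:
  assumes "x \<in> V" "y \<in> V" "z \<in> V" "w \<in> V"
  shows "d x y + d z w \<le> max (d x z + d y w) (d x w + d y z)"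
  using assms(4)
proof (induction "gdist T z w" arbitrary: w)
  case 0
  then have "z = w" using gdist_eq_0 assms by metis
  then show ?case using assms d_triangle[of x z y] gdist_commute[of z y] by simp
next
  case (Suc n)
  obtain w' where w': "adj w' w" "gdist T z w' = n"
    using gdist_pred[OF assms(3) Suc.prems Suc.hyps(2)[symmetric]] by blast
  have V: "w' \<in> V" "w \<in> V" using adjD[OF w'(1)] by auto
  have IH: "d x y + d z w' \<le> max (d x z + d y w') (d x w' + d y z)"
    using Suc.hyps w' V by blast
  have z: "d z w = d z w' + 1" using Suc.hyps(2) w' by simp
  note sep = separating_edge[OF _ assms(3) adj_sym[OF w'(1)] _ z]
  have ww: "d x w = d x w' + 1 \<or> d x w = d x w' - 1" "d y w = d y w' + 1 \<or> d y w = d y w' - 1"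
    using adj_dist[OF _ w'(1)] assms by auto
  show ?case
  proof (cases "d x w = d x w' + 1")
    case True
    show ?thesis
    proof (cases "d y w = d y w' + 1")
      case True
      then show ?thesis using IH z \<open>d x w = d x w' + 1\<close> by linarith
    next
      case False
      then have m: "d y w = d y w' - 1" using ww by simp
      have "d y x = d y w' + d x w'"
        using separating_edge[OF assms(2,1) adj_sym[OF w'(1)] m True] .
      moreover have "d y z = d y w' + d z w'" using sep[OF assms(2) m] .
      ultimately show ?thesis using z True gdist_commute[of x y] assms by simp
    qed
  next
    case False
    then have m: "d x w = d x w' - 1" using ww by simp
    have xz: "d x z = d x w' + d z w'" using sep[OF assms(1) m] .
    show ?thesis
    proof (cases "d y w = d y w' + 1")
      case True
      have "d x y = d x w' + d y w'"
        using separating_edge[OF assms(1,2) adj_sym[OF w'(1)] m True] .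
      then show ?thesis using z xz True by simp
    next
      case False
      then have "d y w = d y w' - 1" using ww by simp
      then show ?thesis using z m xz d_triangle[of x w y] gdist_commute[of w y] assms V by simp
    qed
  qed
qed

end

section \<open>Lines and projections onto them\<close>

context tree
begin

text \<open>Bi-infinite geodesics. In a tree they are the same as bi-infinite injective paths,
  see \<open>bi_infinite_path_iff_line\<close>.\<close>
definition line :: "(int \<Rightarrow> 'a) \<Rightarrow> bool" where
  "line c \<longleftrightarrow> (\<forall>k. c k \<in> V) \<and> (\<forall>i j. d (c i) (c j) = \<bar>i - j\<bar>)"

lemma lineD:
  assumes "line c"
  shows "c k \<in> V" "d (c i) (c j) = \<bar>i - j\<bar>"
  using assms unfolding line_def by blast+

lemma line_eq_iff:
  assumes c: "line c" shows "c i = c j \<longleftrightarrow> i = j"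
proof
  assume "c i = c j"
  then have "d (c i) (c j) = 0" using gdist_refl[OF lineD(1)[OF c]] by simp
  then show "i = j" using lineD(2)[OF c] by simp
qed simp

lemma line_adj_iff:
  assumes c: "line c" shows "adj (c i) (c j) \<longleftrightarrow> \<bar>i - j\<bar> = 1"
proof -
  have "gdist T (c i) (c j) = 1 \<longleftrightarrow> d (c i) (c j) = 1" by linarith
  then show ?thesis using adj_iff[OF lineD(1)[OF c] lineD(1)[OF c]] lineD(2)[OF c] by metis
qed

text \<open>Seen from \<open>c i\<close>, the predecessor of \<open>c k\<close> on the path is its unique neighbour that
  is closer, so a path that does not turn back keeps increasing its distance from \<open>c i\<close>.\<close>
lemma nonbacktracking_line:
  assumes adj: "\<And>k. adj (c k) (c (k + 1))" and nb: "\<And>k. c (k + 2) \<noteq> c k"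
  shows "line c"
proof -
  have V: "c k \<in> V" for k using adjD(1)[OF adj] .
  have fwd: "gdist T (c i) (c (i + int n)) = n \<and> gdist T (c i) (c (i + int (Suc n))) = Suc n" for i n
  proof (induction n)
    case 0
    have "adj (c i) (c (i + 1))" by (rule adj)
    then show ?case using V adj_iff[OF V V, of i "i + 1"] by simp
  next
    case (Suc n)
    let ?k = "i + int n"
    have 1: "adj (c (?k + 2)) (c (?k + 1))"
      using adj[of "?k + 1"] by (simp add: add.assoc insert_commute)
    have 2: "adj (c ?k) (c (?k + 1))" by (rule adj)
    have IH: "gdist T (c i) (c ?k) = n" "gdist T (c i) (c (?k + 1)) = Suc n"
      using Suc by (auto simp: algebra_simps)
    have "\<not> gdist T (c i) (c (?k + 2)) \<le> gdist T (c i) (c (?k + 1))"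
      using parent_unique[OF V 1 2, of i] nb[of ?k] IH by auto
    then have "gdist T (c i) (c (?k + 2)) = Suc (Suc n)"
      using adj_dist[OF V adj_sym[OF 1], of i] IH by linarith
    then show ?case using IH by (simp add: algebra_simps)
  qed
  have "d (c i) (c j) = \<bar>i - j\<bar>" if "i \<le> j" for i j
    using fwd[of i "nat (j - i)"] that by simp
  then have "d (c i) (c j) = \<bar>i - j\<bar>" for i j
    by (metis gdist_commute abs_minus_commute linear)
  then show ?thesis using V by (simp add: line_def)
qed

lemma bi_infinite_path_iff_line: "bi_infinite_path T c \<longleftrightarrow> line c"
proof
  assume c: "bi_infinite_path T c"
  show "line c"
  proof (rule nonbacktracking_line)
    fix k
    show "adj (c k) (c (k + 1))" using c by (simp add: bi_infinite_path_def)
    have "inj c" using c by (simp add: bi_infinite_path_def)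
    then show "c (k + 2) \<noteq> c k" by (simp add: inj_eq)
  qed
next
  assume c: "line c"
  show "bi_infinite_path T c"
    using lineD(1)[OF c] line_adj_iff[OF c] line_eq_iff[OF c] by (auto simp: bi_infinite_path_def inj_def)
qed

text \<open>The parameter of the nearest-point projection of \<open>v\<close> onto the line \<open>c\<close>. It is
  described by the distances to all points of the line, which is the form in which it is
  used.\<close>
definition pos :: "(int \<Rightarrow> 'a) \<Rightarrow> 'a \<Rightarrow> int" where
  "pos c v = (SOME k. \<forall>m. d v (c m) = d v (c k) + \<bar>m - k\<bar>)"

text \<open>Take \<open>k\<close> with \<open>c k\<close> closest to \<open>v\<close>. The distance to \<open>v\<close> must grow at the first step
  away from \<open>c k\<close>, and by the four-point condition it then keeps growing at unit speed.\<close>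
lemma pos_exists:
  assumes c: "line c" and v: "v \<in> V"
  shows "\<exists>k. \<forall>m. d v (c m) = d v (c k) + \<bar>m - k\<bar>"
proof -
  obtain k where min: "gdist T v (c k) \<le> gdist T v (c m)" for m
    using ex_has_least_nat[of "\<lambda>_. True" 0 "\<lambda>k. gdist T v (c k)"] by auto
  have V: "c i \<in> V" for i using c by (rule lineD)
  note D = lineD(2)[OF c]
  have beyond: "d v (c m) \<ge> d v (c k) + \<bar>m - k\<bar>"
    if "\<bar>k' - k\<bar> = 1" "\<bar>m - k'\<bar> = \<bar>m - k\<bar> - 1" for k' m
  proof -
    have "adj (c k) (c k')" using that c by (simp add: line_adj_iff)
    then have "d v (c k') = d v (c k) + 1"
      using adj_dist[OF v] min[of k'] by force
    moreover have "d v (c k') + \<bar>k - m\<bar> \<le> max (d v (c k) + \<bar>k' - m\<bar>) (d v (c m) + \<bar>k' - k\<bar>)"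
      using four_point[OF v V V V, of k' k m] by (simp only: D)
    ultimately show ?thesis using that by linarith
  qed
  have "d v (c m) = d v (c k) + \<bar>m - k\<bar>" for m
  proof (rule antisym)
    show "d v (c m) \<le> d v (c k) + \<bar>m - k\<bar>"
      using d_triangle[OF v V V, of m k] D[of k m] by linarith
    consider "m = k" | "m > k" | "m < k" by linarith
    then show "d v (c k) + \<bar>m - k\<bar> \<le> d v (c m)"
      by cases (use beyond[of "k + 1" m] beyond[of "k - 1" m] in auto)
  qed
  then show ?thesis by blast
qed

lemma dist_via_pos:
  assumes "line c" "v \<in> V"
  shows "d v (c m) = d v (c (pos c v)) + \<bar>m - pos c v\<bar>"
  using someI_ex[OF pos_exists[OF assms]] unfolding pos_def by blast

lemma pos_eqI:
  assumes "line c" "v \<in> V" "\<And>m. d v (c m) = d v (c k) + \<bar>m - k\<bar>"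
  shows "pos c v = k"
  using dist_via_pos[OF assms(1,2), of k] assms(3)[of "pos c v"] by linarith

lemma pos_line [simp]: "line c \<Longrightarrow> pos c (c k) = k"
  by (rule pos_eqI) (simp_all add: lineD(1) lineD(2)[of c])

text \<open>A geodesic between vertices with different projections runs along the line. With
  \<open>a\<close>, \<open>b\<close> the projections of \<open>v\<close>, \<open>w\<close>, the sum \<open>d v b + d w a\<close> exceeds \<open>d v a + d w b\<close> by
  \<open>2 * d a b\<close>, so the four-point condition makes it equal to \<open>d v w + d a b\<close>.\<close>
lemma bridge:
  assumes c: "line c" and V: "v \<in> V" "w \<in> V" and ne: "pos c v \<noteq> pos c w"
  shows "d v w = d v (c (pos c v)) + \<bar>pos c v - pos c w\<bar> + d w (c (pos c w))"
proof -
  let ?a = "c (pos c v)" and ?b = "c (pos c w)"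
  have ab: "?a \<in> V" "?b \<in> V" and D: "d ?a ?b = \<bar>pos c v - pos c w\<bar>" using lineD[OF c] by auto
  have va: "d v ?b = d v ?a + d ?a ?b" and wb: "d w ?a = d w ?b + d ?a ?b"
    using dist_via_pos[OF c V(1), of "pos c w"] dist_via_pos[OF c V(2), of "pos c v"] D by linarith+
  have "d v ?b + d w ?a \<le> max (d v w + d ?a ?b) (d v ?a + d w ?b)"
    using four_point[OF V(1) ab(2) V(2) ab(1)] gdist_commute[of ?b ?a] gdist_commute[of ?b w] by simp
  then have "d v w \<ge> d v ?a + d ?a ?b + d w ?b" using va wb D ne by linarith
  moreover have "d v w \<le> d v ?a + d ?a ?b + d w ?b"
    using d_triangle[OF V(1) ab(2) V(2)] va gdist_commute[of ?b w] by linarith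
  ultimately show ?thesis using D by linarith
qed

text \<open>The vertices \<open>c k\<close> with this property are those of the projection of the line \<open>c'\<close>
  onto the line \<open>c\<close>.\<close>
definition nearest :: "(int \<Rightarrow> 'a) \<Rightarrow> (int \<Rightarrow> 'a) \<Rightarrow> int \<Rightarrow> bool" where
  "nearest c c' k \<longleftrightarrow> (\<exists>m. \<forall>i j. d (c k) (c' m) \<le> d (c i) (c' j))"

text \<open>If \<open>c i\<close> also projects to \<open>c' m\<close>, the two nearest-point properties combine to the
  inequality. Otherwise the geodesic from \<open>c i\<close> to \<open>c k\<close> runs through \<open>c' m\<close>, a vertex whose
  closest point on \<open>c\<close> is \<open>c k\<close>; this forces \<open>c' m = c k\<close>, and the lines meet there.\<close>
lemma mutual_projections_nearest:
  assumes c: "line c" "line c'" and "pos c' (c k) = m" "pos c (c' m) = k"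
  shows "d (c k) (c' m) \<le> d (c i) (c' j)"
proof (cases "pos c' (c i) = m")
  case True
  have V: "c i \<in> V" "c k \<in> V" "c' m \<in> V" using lineD(1)[OF c(1)] lineD(1)[OF c(2)] by auto
  have "d (c i) (c' m) \<le> d (c i) (c' j)" using dist_via_pos[OF c(2) V(1), of j] True by simp
  moreover have "d (c' m) (c k) \<le> d (c' m) (c i)"
    using dist_via_pos[OF c(1) V(3), of i] assms(4) by simp
  ultimately show ?thesis using gdist_commute[of "c' m"] by simp
next
  case False
  have V: "c i \<in> V" "c k \<in> V" "c' m \<in> V" "c' (pos c' (c i)) \<in> V" using lineD(1)[OF c(1)] lineD(1)[OF c(2)] by auto
  have "d (c i) (c k) = d (c i) (c' (pos c' (c i))) + \<bar>pos c' (c i) - m\<bar> + d (c k) (c' m)"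
    using bridge[OF c(2) V(1,2)] False assms(3) by simp
  moreover have "d (c' m) (c i) = d (c' m) (c k) + \<bar>i - k\<bar>"
    using dist_via_pos[OF c(1) V(3), of i] assms(4) by simp
  moreover have "d (c' m) (c i) = d (c i) (c' (pos c' (c i))) + \<bar>m - pos c' (c i)\<bar>"
    using dist_via_pos[OF c(2) V(1), of m] gdist_commute[of "c' m"] by simp
  ultimately have "d (c k) (c' m) = 0" using lineD(2)[OF c(1), of i k] gdist_commute[of "c' m"] by simp
  then show ?thesis by simp
qed

text \<open>Let \<open>b\<close> be the projection of \<open>v\<close> onto \<open>c'\<close> and \<open>a\<close> that of \<open>b\<close> onto \<open>c\<close>. The
  projection of \<open>a\<close> back onto \<open>c'\<close> lies on the geodesic from \<open>b\<close> to \<open>a\<close>, so it also projects to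
  \<open>a\<close>, and \<open>a\<close> is one end of a pair of mutual projections.\<close>
lemma nearest_if_projection_returns:
  assumes c: "line c" "line c'" and v: "v \<in> V" and eq: "pos c (c' (pos c' v)) = pos c v"
  shows "nearest c c' (pos c v)"
proof -
  let ?k = "pos c v"
  define y where "y = pos c' v"
  define m where "m = pos c' (c ?k)"
  have V: "c i \<in> V" "c' i \<in> V" for i using lineD(1)[OF c(1)] lineD(1)[OF c(2)] by auto
  have "pos c (c' m) = ?k"
  proof (rule pos_eqI[OF c(1) V(2)])
    fix i
    have yi: "d (c' y) (c j) = d (c' y) (c ?k) + \<bar>j - ?k\<bar>" for j
      using dist_via_pos[OF c(1) V(2), of y j] eq by (simp add: y_def)
    have "d (c' y) (c ?k) = \<bar>y - m\<bar> + d (c' m) (c ?k)"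
      using dist_via_pos[OF c(2) V(1), of ?k y] gdist_commute[of "c ?k"] by (simp add: m_def)
    moreover have "d (c' y) (c i) \<le> \<bar>y - m\<bar> + d (c' m) (c i)"
      using d_triangle[OF V(2) V(2) V(1), of y i m] lineD(2)[OF c(2), of y m] by simp
    moreover have "d (c' m) (c i) \<le> d (c' m) (c ?k) + \<bar>i - ?k\<bar>"
      using d_triangle[OF V(2) V(1) V(1), of m i ?k] lineD(2)[OF c(1), of ?k i] by simp
    ultimately show "d (c' m) (c i) = d (c' m) (c ?k) + \<bar>i - ?k\<bar>" using yi[of i] by linarith
  qed
  then show ?thesis
    unfolding nearest_def using mutual_projections_nearest[OF c, of ?k m] m_def by blast
qed

text \<open>Let \<open>a\<close> and \<open>b\<close> be the projections of \<open>v\<close> onto the two lines. If \<open>b\<close> did not project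
  to \<open>a\<close>, the geodesic from \<open>v\<close> to \<open>b\<close> would pass \<open>a\<close> and \<open>v\<close> would be strictly closer to \<open>a\<close>
  than to \<open>b\<close>; symmetrically for \<open>a\<close>. Both cannot happen, so one of the two projects to the
  other.\<close>
lemma projections_nearest:
  assumes c: "line c" "line c'" and v: "v \<in> V"
  shows "nearest c c' (pos c v) \<or> nearest c' c (pos c' v)"
proof -
  let ?k = "pos c v" and ?y = "pos c' v"
  have V: "c i \<in> V" "c' i \<in> V" for i using lineD(1)[OF c(1)] lineD(1)[OF c(2)] by auto
  have "pos c (c' ?y) = ?k \<or> pos c' (c ?k) = ?y"
  proof (rule ccontr)
    assume n: "\<not> ?thesis"
    have "d v (c' ?y) \<ge> d v (c ?k) + \<bar>?k - pos c (c' ?y)\<bar>"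
      using bridge[OF c(1) v V(2), of ?y] n by simp
    moreover have "d v (c ?k) \<ge> d v (c' ?y) + \<bar>?y - pos c' (c ?k)\<bar>"
      using bridge[OF c(2) v V(1), of ?k] n by simp
    ultimately show False using n by linarith
  qed
  then show ?thesis using nearest_if_projection_returns c v by blast
qed

end

section \<open>Isometries and their axes\<close>

lemma int_div_mod_plus_one:
  assumes "(l :: int) > 0" "k mod l + 1 < l"
  shows "(k + 1) div l = k div l" "(k + 1) mod l = k mod l + 1"
proof -
  have e: "k + 1 = l * (k div l) + (k mod l + 1)" using mult_div_mod_eq[of l k] by linarith
  have n: "0 \<le> k mod l + 1" using pos_mod_sign[OF assms(1), of k] by linarith
  show "(k + 1) div l = k div l" by (rule int_div_pos_eq[OF e n assms(2)])
  show "(k + 1) mod l = k mod l + 1" by (rule int_mod_pos_eq[OF e n assms(2)])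
qed

lemma int_div_mod_plus_one_wrap:
  assumes "(l :: int) > 0" "k mod l = l - 1"
  shows "(k + 1) div l = k div l + 1" "(k + 1) mod l = 0"
proof -
  have e: "k + 1 = l * (k div l + 1) + 0"
    unfolding distrib_left using mult_div_mod_eq[of l k] assms by linarith
  show "(k + 1) div l = k div l + 1" by (rule int_div_pos_eq[OF e order_refl assms(1)])
  show "(k + 1) mod l = 0" by (rule int_mod_pos_eq[OF e order_refl assms(1)])
qed

context tree
begin

definition isometry :: "('a \<Rightarrow> 'a) \<Rightarrow> bool" where
  "isometry g \<longleftrightarrow> g ` V = V \<and> (\<forall>x\<in>V. \<forall>y\<in>V. gdist T (g x) (g y) = gdist T x y)"

lemma isometryD:
  assumes "isometry g"
  shows "x \<in> V \<Longrightarrow> g x \<in> V" "x \<in> V \<Longrightarrow> y \<in> V \<Longrightarrow> gdist T (g x) (g y) = gdist T x y"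
  using assms by (auto simp: isometry_def)

lemma isometry_adj: "isometry g \<Longrightarrow> adj u v \<Longrightarrow> adj (g u) (g v)"
  using isometryD[of g] adjD[of u v] by (simp add: adj_iff)

lemma pos_translate:
  assumes c: "line c" and g: "isometry g" and tr: "\<And>k. g (c k) = c (k + l)" and v: "v \<in> V"
  shows "pos c (g v) = pos c v + l"
proof (rule pos_eqI[OF c isometryD(1)[OF g v]])
  fix m
  have "d (g v) (c (k + l)) = d v (c k)" for k
    using isometryD(2)[OF g v] lineD(1)[OF c] tr by metis
  from this[of "m - l"] this[of "pos c v"]
  show "d (g v) (c m) = d (g v) (c (pos c v + l)) + \<bar>m - (pos c v + l)\<bar>"
    using dist_via_pos[OF c v, of "m - l"] by (simp add: algebra_simps)
qed

text \<open>By \<open>bridge\<close>, a vertex at distance \<open>n\<close> from the line is displaced by \<open>2 * n + l\<close>. The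
  line is thus determined by \<open>g\<close> alone, which makes the axis of a hyperbolic isometry well
  defined.\<close>
lemma axis_vertices:
  assumes c: "line c" and g: "isometry g" and tr: "\<And>k. g (c k) = c (k + l)" and l: "l > 0"
  shows "range c = {v \<in> V. d v (g v) = l}"
proof (intro equalityI subsetI)
  fix v assume "v \<in> range c"
  then show "v \<in> {v \<in> V. d v (g v) = l}" using lineD[OF c] tr l by auto
next
  fix v assume "v \<in> {v \<in> V. d v (g v) = l}"
  then have v: "v \<in> V" "d v (g v) = l" by auto
  have gv: "pos c (g v) = pos c v + l" using pos_translate[OF c g tr] v by simp
  have "d v (c (pos c v)) = 0"
    using bridge[OF c v(1) isometryD(1)[OF g v(1)]] gv v l by simp
  then show "v \<in> range c" using gdist_eq_0[OF v(1) lineD(1)[OF c]] by simp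
qed

lemma range_path_points:
  assumes c: "line c" "line c'" and sub: "range c \<subseteq> range c'"
  shows "path_points T c \<subseteq> path_points T c'"
proof
  fix p assume "p \<in> path_points T c"
  then obtain k where p: "p \<in> realization T" "supp p \<subseteq> {c k, c (k + 1)}"
    by (auto simp: path_points_def)
  obtain m m' where m: "c k = c' m" "c (k + 1) = c' m'" using sub by (meson rangeE rangeI subsetD)
  have "\<bar>m - m'\<bar> = 1" using line_adj_iff[OF c(1), of k "k + 1"] line_adj_iff[OF c(2), of m m'] m by simp
  then have "m' = m + 1 \<or> m = m' + 1" by linarith
  then have "supp p \<subseteq> {c' (min m m'), c' (min m m' + 1)}" using p m by auto
  then show "p \<in> path_points T c'" using p by (auto simp: path_points_def)
qed

text \<open>Since \<^const>\<open>axis\<close> is given by a definite description, its use requires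
  uniqueness.\<close>
lemma axis_eq:
  assumes c: "line c" and g: "isometry g" and tr: "\<And>k. g (c k) = c (k + int (tlen T g))"
    and hyp: "hyperbolic T g"
  shows "axis T g = path_points T c"
  unfolding axis_def
proof (rule the_equality)
  show "\<exists>c'. bi_infinite_path T c' \<and> (\<forall>k. g (c' k) = c' (k + int (tlen T g))) \<and>
      path_points T c = path_points T c'"
    using c tr by (auto simp: bi_infinite_path_iff_line)
next
  fix A
  assume "\<exists>c'. bi_infinite_path T c' \<and> (\<forall>k. g (c' k) = c' (k + int (tlen T g))) \<and> A = path_points T c'"
  then obtain c' where c': "line c'" "\<And>k. g (c' k) = c' (k + int (tlen T g))" "A = path_points T c'"
    by (auto simp: bi_infinite_path_iff_line)
  have l: "int (tlen T g) > 0" using hyp by (simp add: hyperbolic_def)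
  have "range c = range c'"
    using axis_vertices[OF c g tr l] axis_vertices[OF c'(1) g c'(2) l] by simp
  then show "A = path_points T c" using range_path_points c c' by (metis order_refl subset_antisym)
qed

lemma geodesic:
  assumes "x \<in> V" "y \<in> V"
  obtains p where "p 0 = x" "p (gdist T x y) = y" "\<And>i. i < gdist T x y \<Longrightarrow> adj (p i) (p (Suc i))"
    "\<And>i. i \<le> gdist T x y \<Longrightarrow> p i \<in> V \<and> gdist T x (p i) = i \<and> gdist T (p i) y = gdist T x y - i"
proof -
  have "\<exists>p. p 0 = x \<and> p (gdist T x y) = y \<and> (\<forall>i<gdist T x y. adj (p i) (p (Suc i))) \<and>
    (\<forall>i\<le>gdist T x y. p i \<in> V \<and> gdist T x (p i) = i \<and> gdist T (p i) y = gdist T x y - i)"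
    using assms(2)
  proof (induction "gdist T x y" arbitrary: y)
    case 0
    then have "x = y" using gdist_eq_0 assms by metis
    then show ?case using assms by (intro exI[of _ "\<lambda>_. x"]) auto
  next
    case (Suc n)
    obtain u where u: "adj u y" "gdist T x u = n"
      using gdist_pred[OF assms(1) Suc.prems Suc.hyps(2)[symmetric]] by blast
    obtain p where p: "p 0 = x" "p n = u" "\<And>i. i < n \<Longrightarrow> adj (p i) (p (Suc i))"
      "\<And>i. i \<le> n \<Longrightarrow> p i \<in> V \<and> gdist T x (p i) = i \<and> gdist T (p i) u = n - i"
      using Suc.hyps(1)[of u] u adjD(1)[OF u(1)] by auto
    have "gdist T (p i) y = Suc n - i" if "i \<le> n" for i
      using p(4)[OF that] gdist_step[OF _ u(1), of "p i"] gdist_triangle[OF assms(1) _ Suc.prems, of "p i"]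
        Suc.hyps(2) that by simp
    then show ?case
      using p u Suc.prems Suc.hyps(2)[symmetric] 
      by (intro exI[of _ "p(Suc n := y)"]) (auto simp: less_Suc_eq le_Suc_eq)
  qed
  then show ?thesis using that by blast
qed

lemma Isom_group: "group (Isom T)"
proof -
  interpret B: group "BijGroup V" by (rule group_BijGroup)
  let ?C = "{g \<in> Bij V. \<forall>x\<in>V. \<forall>y\<in>V. gdist T (g x) (g y) = gdist T x y}"
  have mem: "f x \<in> V" if "f \<in> Bij V" "x \<in> V" for f x
    using that by (auto simp: Bij_def dest: bij_betwE)
  have "subgroup ?C (BijGroup V)"
  proof (rule B.subgroupI)
    show "?C \<subseteq> carrier (BijGroup V)" by (auto simp: BijGroup_def)
    have "(\<lambda>x\<in>V. x) \<in> ?C" by (auto simp: id_Bij)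
    then show "?C \<noteq> {}" by blast
  next
    fix f g assume f: "f \<in> ?C" and g: "g \<in> ?C"
    then show "f \<otimes>\<^bsub>BijGroup V\<^esub> g \<in> ?C"
      by (auto simp: BijGroup_def compose_Bij compose_eq mem)
  next
    fix f assume f: "f \<in> ?C"
    have "gdist T (inv_into V f x) (inv_into V f y) = gdist T x y" if "x \<in> V" "y \<in> V" for x y
    proof -
      have im: "f ` V = V" using f by (auto simp: Bij_def bij_betw_def)
      then have "inv_into V f x \<in> V" "inv_into V f y \<in> V"
        "f (inv_into V f x) = x" "f (inv_into V f y) = y"
        using that by (auto intro: inv_into_into f_inv_into_f)
      then show ?thesis using f by (metis (mono_tags, lifting) mem_Collect_eq)
    qed
    then show "inv\<^bsub>BijGroup V\<^esub> f \<in> ?C"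
      using f by (auto simp: inv_BijGroup restrict_inv_into_Bij)
  qed
  then show ?thesis unfolding Isom_def by (rule B.subgroup_imp_group)
qed

lemma Isom_carrier:
  "g \<in> carrier (Isom T) \<longleftrightarrow> g \<in> Bij V \<and> (\<forall>x\<in>V. \<forall>y\<in>V. gdist T (g x) (g y) = gdist T x y)"
  by (simp add: Isom_def)

lemma Isom_isometry: "g \<in> carrier (Isom T) \<Longrightarrow> isometry g"
  by (auto simp: Isom_carrier isometry_def Bij_def bij_betw_def)

lemma Isom_mult_apply:
  "f \<in> carrier (Isom T) \<Longrightarrow> g \<in> carrier (Isom T) \<Longrightarrow> x \<in> V \<Longrightarrow> (f \<otimes>\<^bsub>Isom T\<^esub> g) x = f (g x)"
  by (simp add: Isom_carrier Isom_def BijGroup_def compose_eq)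

lemma Isom_one_apply: "x \<in> V \<Longrightarrow> \<one>\<^bsub>Isom T\<^esub> x = x"
  by (simp add: Isom_def BijGroup_def)

lemma tlen_attained:
  obtains x where "x \<in> V" "gdist T x (g x) = tlen T g"
proof -
  have "V \<noteq> {}" using simplicial by (simp add: simplicial_tree_def)
  then have "(INF x\<in>V. gdist T x (g x)) \<in> (\<lambda>x. gdist T x (g x)) ` V"
    by (intro Inf_nat_def1) simp
  then show ?thesis using that by (auto simp: tlen_def)
qed

lemma tlen_le: "x \<in> V \<Longrightarrow> tlen T g \<le> gdist T x (g x)"
  unfolding tlen_def by (rule cINF_lower) auto

text \<open>Join a vertex \<open>x\<close> of least displacement to \<open>g x\<close> by a geodesic \<open>p\<close> and concatenate
  the translates of \<open>p\<close> by the powers of \<open>g\<close>. If this path turned back, it would do so at a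
  translate of \<open>g x\<close>, that is, \<open>g\<close> would map the second vertex of \<open>p\<close> to its last but one. That
  vertex is then displaced by at most \<open>l - 2\<close>, which is too little, or \<open>l = 1\<close> and \<open>g\<close> exchanges
  \<open>x\<close> and \<open>g x\<close>.\<close>
lemma axis_exists:
  assumes g: "g \<in> carrier (Isom T)" and hyp: "hyperbolic T g" and inv: "\<not> is_inversion T g"
  obtains c where "line c" "\<And>k. g (c k) = c (k + int (tlen T g))"
proof -
  interpret I: group "Isom T" by (rule Isom_group)
  have iso: "isometry g" using Isom_isometry g .
  define n where "n = tlen T g"
  define l where "l = int n"
  have l: "l > 0" "n > 0" using hyp by (auto simp: hyperbolic_def l_def n_def)
  obtain x where x: "x \<in> V" "gdist T x (g x) = n" using tlen_attained n_def by metis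
  obtain p where p: "p 0 = x" "p n = g x" "\<And>i. i < n \<Longrightarrow> adj (p i) (p (Suc i))"
    "\<And>i. i \<le> n \<Longrightarrow> p i \<in> V \<and> gdist T x (p i) = i \<and> gdist T (p i) (g x) = n - i"
    using geodesic[OF x(1) isometryD(1)[OF iso x(1)]] x(2) by metis
  define gq where "gq q = g [^]\<^bsub>Isom T\<^esub> (q :: int)" for q
  have gq: "gq q \<in> carrier (Isom T)" for q using g by (simp add: gq_def)
  have gq1: "gq (q + 1) = gq q \<otimes>\<^bsub>Isom T\<^esub> g" "gq (q + 1) = g \<otimes>\<^bsub>Isom T\<^esub> gq q" for q
    using I.int_pow_mult[OF g, of q 1] I.int_pow_mult[OF g, of 1 q] g
    by (auto simp: gq_def add.commute)
  have gq_inj: "gq q u = gq q v \<Longrightarrow> u \<in> V \<Longrightarrow> v \<in> V \<Longrightarrow> u = v" for q u v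
    using gq[of q] by (auto simp: Isom_carrier Bij_def bij_betw_def inj_on_def)
  define c where "c k = gq (k div l) (p (nat (k mod l)))" for k
  have r: "nat (k mod l) < n" for k using l by (simp add: l_def nat_less_iff)
  have c_suc: "c (k + 1) = gq (k div l) (p (Suc (nat (k mod l))))" for k
  proof (cases "k mod l + 1 < l")
    case True
    then have "(k + 1) div l = k div l" "(k + 1) mod l = k mod l + 1"
      using int_div_mod_plus_one[OF l(1)] by auto
    then show ?thesis using l by (simp add: c_def Suc_nat_eq_nat_zadd1 add.commute)
  next
    case False
    then have m: "k mod l = l - 1" using l pos_mod_bound[of l k] by linarith
    then have "(k + 1) div l = k div l + 1" "(k + 1) mod l = 0"
      using int_div_mod_plus_one_wrap[OF l(1)] by auto
    moreover have "Suc (nat (k mod l)) = n" using m l by (simp add: l_def)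
    ultimately show ?thesis using p x gq g by (simp add: c_def gq1(1) Isom_mult_apply)
  qed
  have "line c"
  proof (rule nonbacktracking_line)
    fix k
    show "adj (c k) (c (k + 1))"
      unfolding c_suc unfolding c_def by (rule isometry_adj[OF Isom_isometry[OF gq] p(3)[OF r]])
    have c2: "c (k + 2) = gq ((k + 1) div l) (p (Suc (nat ((k + 1) mod l))))"
      using c_suc[of "k + 1"] by (simp add: add.assoc)
    have ck: "c k = gq (k div l) (p (nat (k mod l)))" by (simp add: c_def)
    show "c (k + 2) \<noteq> c k"
    proof
      assume eq: "c (k + 2) = c k"
      let ?r = "nat (k mod l)"
      have pr: "p ?r \<in> V" using p(4) r[of k] by simp
      show False
      proof (cases "Suc ?r < n")
        case True
        have "k mod l + 1 < l" using True l by (simp add: l_def)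
        then have "(k + 1) div l = k div l" "nat ((k + 1) mod l) = Suc ?r"
          using int_div_mod_plus_one[OF l(1)] l by (auto simp: Suc_nat_eq_nat_zadd1)
        then have "c (k + 2) = gq (k div l) (p (Suc (Suc ?r)))" using c2 by simp
        then have "p (Suc (Suc ?r)) = p ?r"
          using eq gq_inj[of "k div l"] pr p(4)[of "Suc (Suc ?r)"] True unfolding ck by simp
        then show False using p(4)[of "Suc (Suc ?r)"] p(4)[of ?r] True by simp
      next
        case False
        then have rn: "Suc ?r = n" using r[of k] by simp
        have "k mod l = l - 1" using rn pos_mod_sign[OF l(1), of k] unfolding l_def by linarith
        then have "(k + 1) div l = k div l + 1" "(k + 1) mod l = 0"
          using int_div_mod_plus_one_wrap[OF l(1)] by auto
        then have "c (k + 2) = gq (k div l + 1) (p 1)" using c2 by simp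
        also have "\<dots> = gq (k div l) (g (p 1))"
          using p(4)[of 1] l gq g by (simp add: gq1(1) Isom_mult_apply)
        finally have "g (p 1) = p ?r"
          using eq gq_inj[of "k div l"] pr isometryD(1)[OF iso, of "p 1"] p(4)[of 1] l
          unfolding ck by simp
        then have g1: "g (p 1) = p (n - 1)" using rn by (metis diff_Suc_1)
        show False
        proof (cases "n = 1")
          case True
          then have "is_inversion T g" unfolding is_inversion_def
            using g1 p(1,2) p(3)[of 0] by auto
          then show False using inv by simp
        next
          case False
          have p1: "p 1 \<in> V" "gdist T x (p 1) = 1" using p(4)[of 1] l by auto
          have "gdist T (p i) (p j) \<le> j - i" if "i \<le> j" "j \<le> n" for i j
            using that
          proof (induction j)
            case (Suc j)
            show ?case
            proof (cases "i = Suc j")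
              case False
              then show ?thesis
                using Suc gdist_step[OF _ p(3), of "p i" j] p(4)[of i] by simp
            qed (use Suc p(4) in simp)
          qed (use p(4) in simp)
          from this[of 1 "n - 1"] have "gdist T (p 1) (g (p 1)) \<le> n - 2"
            using g1 False l by (simp add: numeral_2_eq_2)
          then show False using tlen_le[OF p1(1), of g] l False unfolding n_def[symmetric] by simp
        qed
      qed
    qed
  qed
  moreover have "g (c k) = c (k + int (tlen T g))" for k
  proof -
    have "(k + l) div l = k div l + 1" "(k + l) mod l = k mod l" using l by auto
    then have "c (k + l) = gq (k div l + 1) (p (nat (k mod l)))" by (simp add: c_def)
    also have "\<dots> = g (c k)" using r[of k] p(4)[of "nat (k mod l)"] gq g
      by (simp add: gq1(2) Isom_mult_apply c_def)
    finally show ?thesis by (simp add: l_def n_def)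
  qed
  ultimately show ?thesis using that by blast
qed

lemma Isom_inv_apply:
  assumes "g \<in> carrier (Isom T)" "x \<in> V"
  shows "(inv\<^bsub>Isom T\<^esub> g) (g x) = x" "g ((inv\<^bsub>Isom T\<^esub> g) x) = x"
proof -
  interpret I: group "Isom T" by (rule Isom_group)
  show "(inv\<^bsub>Isom T\<^esub> g) (g x) = x"
    using Isom_mult_apply[OF I.inv_closed[OF assms(1)] assms] I.l_inv[OF assms(1)] Isom_one_apply[OF assms(2)]
    by simp
  show "g ((inv\<^bsub>Isom T\<^esub> g) x) = x"
    using Isom_mult_apply[OF assms(1) I.inv_closed[OF assms(1)] assms(2)] I.r_inv[OF assms(1)]
      Isom_one_apply[OF assms(2)] by simp
qed

lemma elliptic_iff_fixes_vertex:
  assumes "g \<in> carrier (Isom T)"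
  shows "elliptic T g \<longleftrightarrow> (\<exists>x\<in>V. g x = x)"
proof
  assume "elliptic T g"
  moreover obtain x where x: "x \<in> V" "gdist T x (g x) = tlen T g" using tlen_attained by blast
  ultimately show "\<exists>x\<in>V. g x = x"
    using gdist_eq_0[OF x(1) isometryD(1)[OF Isom_isometry[OF assms] x(1)]] x(1) by (metis elliptic_def)
next
  assume "\<exists>x\<in>V. g x = x"
  then obtain x where "x \<in> V" "g x = x" by blast
  then show "elliptic T g" using tlen_le[of x g] by (simp add: elliptic_def)
qed

end

section \<open>The realization along a line\<close>

definition vertex_point :: "'a \<Rightarrow> 'a \<Rightarrow> real" where
  "vertex_point u = (\<lambda>v. if v = u then 1 else 0)"

lemma vertex_point_apply [simp]: "vertex_point u v = (if v = u then 1 else 0)"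
  by (simp add: vertex_point_def)

lemma supp_vertex_point [simp]: "supp (vertex_point u) = {u}"
  by (auto simp: supp_def)

text \<open>The point of the line \<open>c\<close> at real parameter \<open>k + t\<close>, for \<open>0 \<le> t < 1\<close>. With
  \<open>t = 1\<close> excluded, every point of the line has exactly one such representation.\<close>
definition line_point :: "(int \<Rightarrow> 'a) \<Rightarrow> int \<Rightarrow> real \<Rightarrow> 'a \<Rightarrow> real" where
  "line_point c k t = (\<lambda>v. if v = c k then 1 - t else if v = c (k + 1) then t else 0)"

lemma line_point_0: "line_point c k 0 = vertex_point (c k)"
  by (auto simp: line_point_def vertex_point_def)

context tree
begin

lemma realizationD:
  assumes "p \<in> realization T"
  shows "finite (supp p)" "supp p \<noteq> {}" "supp p \<subseteq> V" "p a \<ge> 0" "p a \<le> 1"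
    "(\<Sum>v\<in>supp p. p v) = 1"
proof -
  have nn: "\<forall>v. 0 \<le> p v" and s: "(\<exists>v\<in>V. supp p = {v}) \<or> supp p \<in> edges T"
    and 1: "(\<Sum>v\<in>supp p. p v) = 1"
    using assms by (auto simp: realization_def)
  have "supp p \<subseteq> V \<and> card (supp p) = 2" if "supp p \<in> edges T"
    using that simplicial unfolding simplicial_tree_def by blast
  then show f: "finite (supp p)" "supp p \<noteq> {}" "supp p \<subseteq> V"
    using s by (auto intro: card_ge_0_finite)
  show "p a \<ge> 0" "(\<Sum>v\<in>supp p. p v) = 1" using nn 1 by auto
  show "p a \<le> 1"
  proof (cases "a \<in> supp p")
    case True
    then have "p a \<le> (\<Sum>v\<in>supp p. p v)" using nn f(1) by (intro member_le_sum) auto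
    then show ?thesis using 1 by simp
  next
    case False
    then show ?thesis by (simp add: supp_def)
  qed
qed

lemma vertex_point_realization: "v \<in> V \<Longrightarrow> vertex_point v \<in> realization T"
  by (simp add: realization_def)

lemma rdist_common_edge:
  assumes "adj a b" "supp p \<union> supp q \<subseteq> {a, b}"
  shows "rdist T p q = (\<bar>p a - q a\<bar> + \<bar>p b - q b\<bar>) / 2"
proof -
  have "(\<Sum>v\<in>supp p \<union> supp q. \<bar>p v - q v\<bar>) = (\<Sum>v\<in>{a, b}. \<bar>p v - q v\<bar>)"
    using assms(2) by (intro sum.mono_neutral_left) (auto simp: supp_def)
  also have "\<dots> = \<bar>p a - q a\<bar> + \<bar>p b - q b\<bar>" using adjD(3)[OF assms(1)] by simp
  finally show ?thesis using assms unfolding rdist_def by auto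
qed

text \<open>Vertices \<open>a\<close>, \<open>b\<close> at distance at least 2 witness that the two supports lie in no
  common edge, so the second clause of the definition applies.\<close>
lemma rdist_far:
  assumes "a \<in> supp p" "b \<in> supp q" "gdist T a b \<ge> 2"
  shows "rdist T p q = Min {(1 - p a) + real (gdist T a b) + (1 - q b) | a b. a \<in> supp p \<and> b \<in> supp q}"
proof -
  have False if e: "e \<in> edges T" "supp p \<union> supp q \<subseteq> e" for e
  proof -
    have e2: "e \<subseteq> V" "card e = 2" using e(1) simplicial unfolding simplicial_tree_def by blast+
    have ab: "a \<in> e" "b \<in> e" using assms e by auto
    then have V: "a \<in> V" "b \<in> V" using e2 by auto
    have "a \<noteq> b" using assms(3) V by auto
    then have "e = {a, b}" using ab e2(2) by (auto simp: card_2_iff)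
    then have "gdist T a b = 1" using adj_iff[OF V] e by simp
    then show False using assms(3) by simp
  qed
  moreover have False if "v \<in> V" "supp p \<union> supp q = {v}" for v
  proof -
    have "a = v" "b = v" using assms that by auto
    then show False using assms(3) that(1) by simp
  qed
  ultimately show ?thesis unfolding rdist_def by auto
qed

lemma rdist_commute: "rdist T p q = rdist T q p"
proof -
  let ?S = "\<lambda>p q. {(1 - p a) + real (gdist T a b) + (1 - q b) | a b. a \<in> supp p \<and> b \<in> supp q}"
  have sub: "?S p q \<subseteq> ?S q p" for p q
  proof
    fix x assume "x \<in> ?S p q"
    then obtain a b where ab: "a \<in> supp p" "b \<in> supp q"
      and "x = (1 - p a) + real (gdist T a b) + (1 - q b)" by blast
    then have "x = (1 - q b) + real (gdist T b a) + (1 - p a)" using gdist_commute[of a b] by simp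
    then show "x \<in> ?S q p" using ab by blast
  qed
  have S: "?S p q = ?S q p" using sub sub by (rule equalityI)
  have sum: "(\<Sum>v\<in>supp p \<union> supp q. \<bar>p v - q v\<bar>) = (\<Sum>v\<in>supp p \<union> supp q. \<bar>q v - p v\<bar>)"
    by (intro sum.cong) auto
  show ?thesis unfolding rdist_def S Un_commute[of "supp q" "supp p"] sum ..
qed

lemma rdist_vertex_points:
  assumes "u \<in> V" "w \<in> V"
  shows "rdist T (vertex_point u) (vertex_point w) = real (gdist T u w)"
proof -
  consider "u = w" | "adj u w" | "gdist T u w \<ge> 2"
    using adj_iff[OF assms] gdist_eq_0[OF assms] by linarith
  then show ?thesis
  proof cases
    case 1
    then show ?thesis using assms by (simp add: rdist_def)
  next
    case 2
    then have "rdist T (vertex_point u) (vertex_point w) = 1"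
      using rdist_common_edge[OF 2, of "vertex_point u" "vertex_point w"] adjD(3)[OF 2]
      by simp
    then show ?thesis using 2 adj_iff[OF assms] by simp
  next
    case 3
    then show ?thesis
      using rdist_far[of u "vertex_point u" w "vertex_point w"] by simp
  qed
qed

lemma finite_rdist_set:
  "finite A \<Longrightarrow> finite B \<Longrightarrow> finite {f a b | a b. a \<in> A \<and> b \<in> B}"
proof -
  assume "finite A" "finite B"
  moreover have "{f a b | a b. a \<in> A \<and> b \<in> B} = (\<lambda>(a, b). f a b) ` (A \<times> B)" by auto
  ultimately show ?thesis by simp
qed

text \<open>A bound on distances between the vertices of the supports carries over to the
  points. The delicate case is that of two points with disjoint supports in one edge: they are
  its two ends.\<close>
lemma rdist_ge:
  assumes p: "p \<in> realization T" and q: "q \<in> realization T"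
    and N: "\<And>a b. a \<in> supp p \<Longrightarrow> b \<in> supp q \<Longrightarrow> N \<le> gdist T a b"
  shows "real N \<le> rdist T p q"
proof -
  note P = realizationD[OF p] and Q = realizationD[OF q]
  let ?S = "{(1 - p a) + real (gdist T a b) + (1 - q b) | a b. a \<in> supp p \<and> b \<in> supp q}"
  have "real N \<le> x" if x: "x \<in> ?S" for x
  proof -
    obtain a b where "a \<in> supp p" "b \<in> supp q" "x = (1 - p a) + real (gdist T a b) + (1 - q b)"
      using x by blast
    then show ?thesis using N[of a b] P(5)[of a] Q(5)[of b] by simp
  qed
  moreover have "finite ?S" "?S \<noteq> {}" using P Q by (auto intro: finite_rdist_set)
  ultimately have Min: "real N \<le> Min ?S" by simp
  have near: "real N \<le> (\<Sum>v\<in>supp p \<union> supp q. \<bar>p v - q v\<bar>) / 2"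
    if close: "(\<exists>v\<in>V. supp p \<union> supp q = {v}) \<or> (\<exists>e\<in>edges T. supp p \<union> supp q \<subseteq> e)"
  proof (cases "N = 0")
    case True
    then show ?thesis by (simp add: sum_nonneg)
  next
    case False
    have disj: "supp p \<inter> supp q = {}"
      using False N P(3) gdist_refl by fastforce
    then have p0: "p v = 0" if "v \<in> supp q" for v using that by (auto simp: supp_def)
    obtain a b where ab: "a \<in> supp p" "b \<in> supp q" using P Q by blast
    then have V: "a \<in> V" "b \<in> V" "a \<noteq> b" using P Q disj by auto
    then have "supp p \<union> supp q \<noteq> {v}" for v using ab by (metis UnCI singletonD)
    with close obtain e where e: "e \<in> edges T" "supp p \<union> supp q \<subseteq> e" by blast
    have "card e = 2" using e(1) simplicial unfolding simplicial_tree_def by blast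
    then have "e = {a, b}" using ab V e by (auto simp: card_2_iff)
    then have "N \<le> 1" using N[OF ab] adj_iff[OF V(1,2)] e by simp
    have "(\<Sum>v\<in>supp p \<union> supp q. \<bar>p v - q v\<bar>) =
        (\<Sum>v\<in>supp p. \<bar>p v - q v\<bar>) + (\<Sum>v\<in>supp q. \<bar>p v - q v\<bar>)"
      using P(1) Q(1) disj by (rule sum.union_disjoint)
    also have "(\<Sum>v\<in>supp p. \<bar>p v - q v\<bar>) = (\<Sum>v\<in>supp p. p v)"
      using disj P(4) by (intro sum.cong) (auto simp: supp_def)
    also have "(\<Sum>v\<in>supp q. \<bar>p v - q v\<bar>) = (\<Sum>v\<in>supp q. q v)"
      using p0 Q(4) by (intro sum.cong) auto
    finally show ?thesis using P(6) Q(6) \<open>N \<le> 1\<close> by simp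
  qed
  show ?thesis using Min near unfolding rdist_def by simp
qed

lemma supp_line_point:
  assumes c: "line c" and t: "0 \<le> t" "t < 1"
  shows "supp (line_point c k t) = (if t = 0 then {c k} else {c k, c (k + 1)})"
  using t line_eq_iff[OF c] by (auto simp: supp_def line_point_def)

lemma path_points_cases:
  assumes c: "line c" and p: "p \<in> path_points T c"
  obtains k t where "0 \<le> t" "t < 1" "p = line_point c k t"
proof -
  obtain k where r: "p \<in> realization T" and s: "supp p \<subseteq> {c k, c (k + 1)}"
    using p by (auto simp: path_points_def)
  note R = realizationD[OF r]
  have ne: "c k \<noteq> c (k + 1)" "c (k + 1) \<noteq> c (k + 1 + 1)" using line_eq_iff[OF c] by auto
  have "(\<Sum>v\<in>supp p. p v) = (\<Sum>v\<in>{c k, c (k + 1)}. p v)"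
    using s by (intro sum.mono_neutral_left) (auto simp: supp_def)
  then have 1: "p (c k) + p (c (k + 1)) = 1" using R(6) ne by simp
  have z: "p v = 0" if "v \<noteq> c k" "v \<noteq> c (k + 1)" for v using that s by (auto simp: supp_def)
  show ?thesis
  proof (cases "p (c k) = 0")
    case True
    then have "p v = line_point c (k + 1) 0 v" for v
      using 1 z[of v] ne unfolding line_point_0 by (cases "v = c k") auto
    then have "p = line_point c (k + 1) 0" by (rule ext)
    then show ?thesis using that by force
  next
    case False
    then have "p = line_point c k (p (c (k + 1)))" using 1 z by (auto simp: line_point_def)
    moreover have "p (c (k + 1)) < 1" using 1 False R(4)[of "c k"] by linarith
    ultimately show ?thesis using that R(4) by blast
  qed
qed

lemma vertex_point_path_points: "line c \<Longrightarrow> vertex_point (c k) \<in> path_points T c"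
  using vertex_point_realization[OF lineD(1)] by (auto simp: path_points_def)

lemma rdist_line_points_less:
  assumes c: "line c" and t: "0 \<le> t" "t < 1" and t': "0 \<le> t'" "t' < 1" and k: "k < k'"
  shows "rdist T (line_point c k t) (line_point c k' t') = (of_int k' + t') - (of_int k + t)"
proof -
  let ?p = "line_point c k t" and ?q = "line_point c k' t'"
  note E = line_eq_iff[OF c]
  note S = supp_line_point[OF c t, of k] supp_line_point[OF c t', of k']
  have D: "real (gdist T (c i) (c j)) = real_of_int \<bar>i - j\<bar>" for i j
    using lineD(2)[OF c, of i j] by (metis of_int_of_nat_eq)
  have w: "?p (c k) = 1 - t" "?p (c (k + 1)) = t" "?q (c k') = 1 - t'" "?q (c (k' + 1)) = t'"
    by (simp_all add: line_point_def E)
  show ?thesis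
  proof (cases "k' = k + 1 \<and> t' = 0")
    case True
    have "adj (c k) (c (k + 1))" using line_adj_iff[OF c] by simp
    moreover have "supp ?p \<union> supp ?q \<subseteq> {c k, c (k + 1)}" using S True by auto
    ultimately have "rdist T ?p ?q = (\<bar>?p (c k) - ?q (c k)\<bar> + \<bar>?p (c (k + 1)) - ?q (c (k + 1))\<bar>) / 2"
      by (rule rdist_common_edge)
    moreover have "?q (c k) = 0" "?q (c (k + 1)) = 1" using True by (simp_all add: line_point_0 E)
    ultimately show ?thesis using True t w by simp
  next
    case False
    define j where "j = (if t' = 0 then k' else k' + 1)"
    have j: "c j \<in> supp ?q" "c k \<in> supp ?p" "j \<ge> k + 2" using S k False by (auto simp: j_def)
    then have "gdist T (c k) (c j) \<ge> 2" using D[of k j] by linarith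
    note far = rdist_far[OF j(2,1) this]
    define i where "i = (if t = 0 then k else k + 1)"
    show ?thesis unfolding far
    proof (rule Min_eqI)
      show "finite {(1 - ?p a) + real (gdist T a b) + (1 - ?q b) | a b. a \<in> supp ?p \<and> b \<in> supp ?q}"
        using S by (intro finite_rdist_set) auto
    next
      fix y assume "y \<in> {(1 - ?p a) + real (gdist T a b) + (1 - ?q b) | a b. a \<in> supp ?p \<and> b \<in> supp ?q}"
      then obtain a b where ab: "a \<in> supp ?p" "b \<in> supp ?q"
        and y: "y = (1 - ?p a) + real (gdist T a b) + (1 - ?q b)" by blast
      have a: "a = c k \<or> a = c (k + 1)" and b: "b = c k' \<or> b = c (k' + 1)" using ab S by (auto split: if_splits)
      have k1: "of_int k + 1 \<le> (of_int k' :: real)" using k by linarith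
      show "of_int k' + t' - (of_int k + t) \<le> y"
        using a b t t' k k1 by (elim disjE) (simp_all add: y w D)
    next
      have "c i \<in> supp ?p" "c k' \<in> supp ?q" using S by (auto simp: i_def)
      moreover have "of_int k' + t' - (of_int k + t) =
          (1 - ?p (c i)) + real (gdist T (c i) (c k')) + (1 - ?q (c k'))"
        using k unfolding D by (simp add: i_def w line_point_0)
      ultimately show "of_int k' + t' - (of_int k + t) \<in>
          {(1 - ?p a) + real (gdist T a b) + (1 - ?q b) | a b. a \<in> supp ?p \<and> b \<in> supp ?q}" by blast
    qed
  qed
qed

lemma rdist_line_points:
  assumes c: "line c" and t: "0 \<le> t" "t < 1" and t': "0 \<le> t'" "t' < 1"
  shows "rdist T (line_point c k t) (line_point c k' t') = \<bar>(of_int k + t) - (of_int k' + t')\<bar>"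
proof -
  consider "k < k'" | "k' < k" | "k = k'" by linarith
  then show ?thesis
  proof cases
    case 1
    then have "of_int k + 1 \<le> (of_int k' :: real)" by linarith
    then show ?thesis using rdist_line_points_less[OF c t t' 1] t t' by simp
  next
    case 2
    then have "of_int k' + 1 \<le> (of_int k :: real)" by linarith
    then show ?thesis
      using rdist_commute[of "line_point c k t" "line_point c k' t'"] rdist_line_points_less[OF c t' t 2] t t' by simp
  next
    case 3
    have "adj (c k) (c (k + 1))" using line_adj_iff[OF c] by simp
    moreover have "supp (line_point c k t) \<union> supp (line_point c k t') \<subseteq> {c k, c (k + 1)}"
      unfolding supp_line_point[OF c t] supp_line_point[OF c t'] by auto
    ultimately have "rdist T (line_point c k t) (line_point c k t') =
        (\<bar>line_point c k t (c k) - line_point c k t' (c k)\<bar> +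
         \<bar>line_point c k t (c (k + 1)) - line_point c k t' (c (k + 1))\<bar>) / 2"
      by (rule rdist_common_edge)
    moreover have "line_point c k u (c k) = 1 - u" "line_point c k u (c (k + 1)) = u" for u
      using line_eq_iff[OF c, of "k + 1" k] by (auto simp: line_point_def)
    ultimately show ?thesis using 3 by simp
  qed
qed

text \<open>In real parameters on the line, the open segment lies in an open interval of length
  \<open>l\<close>. Such an interval contains at most \<open>l\<close> integers, and they are consecutive.\<close>
lemma osegment_window:
  assumes c: "line c" and p: "p \<in> path_points T c" and q: "q \<in> path_points T c"
    and l: "rdist T p q = real l"
  obtains m where "\<And>k. vertex_point (c k) \<in> osegment T p q \<Longrightarrow> m \<le> k \<and> k < m + int l"
proof -
  obtain i s where s: "0 \<le> s" "s < 1" "p = line_point c i s" using path_points_cases[OF c p] by blast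
  obtain j t where t: "0 \<le> t" "t < 1" "q = line_point c j t" using path_points_cases[OF c q] by blast
  define x where "x = of_int i + s"
  define y where "y = of_int j + t"
  have xy: "\<bar>x - y\<bar> = real l" using l rdist_line_points[OF c s(1,2) t(1,2)] s t by (simp add: x_def y_def)
  define m where "m = \<lfloor>min x y\<rfloor> + 1"
  have "m \<le> k \<and> k < m + int l" if k: "vertex_point (c k) \<in> osegment T p q" for k
  proof -
    have 0: "vertex_point (c k) = line_point c k 0" by (simp add: line_point_0)
    have "x \<noteq> of_int k"
    proof
      assume "x = of_int k"
      then have i: "of_int i + s = of_int k" by (simp add: x_def)
      then have "i = k" using s(1,2) by linarith
      then have "s = 0" "i = k" using i by simp_all
      then show False using k s(3) 0 by (simp add: osegment_def)
    qed
    moreover have "y \<noteq> of_int k"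
    proof
      assume "y = of_int k"
      then have j: "of_int j + t = of_int k" by (simp add: y_def)
      then have "j = k" using t(1,2) by linarith
      then have "t = 0" "j = k" using j by simp_all
      then show False using k t(3) 0 by (simp add: osegment_def)
    qed
    moreover have "\<bar>x - of_int k\<bar> + \<bar>of_int k - y\<bar> = real l"
      using k l rdist_line_points[OF c s(1,2), of 0 i k] rdist_line_points[OF c _ _ t(1,2), of 0 k j] s(3) t(3)
      unfolding osegment_def 0 by (simp add: x_def y_def)
    ultimately have "min x y < of_int k" "of_int k < min x y + real l"
      using xy by (auto simp: min_def abs_if split: if_splits)
    then show ?thesis unfolding m_def by linarith
  qed
  then show ?thesis using that by blast
qed

text \<open>The infima over points of the realization that define \<^const>\<open>Proj\<close> are attained
  at vertices, by \<open>rdist_ge\<close>.\<close>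
lemma nearest_in_Proj:
  assumes c: "line c" and c': "line c'" and k: "nearest c c' k"
  shows "vertex_point (c k) \<in> Proj T (path_points T c) (path_points T c')"
proof -
  let ?A = "path_points T c" and ?B = "path_points T c'"
  obtain m where m: "\<And>i j. d (c k) (c' m) \<le> d (c i) (c' j)" using k by (auto simp: nearest_def)
  define N where "N = gdist T (c k) (c' m)"
  have Nle: "N \<le> gdist T (c i) (c' j)" for i j using m[of i j] by (simp add: N_def)
  have A: "vertex_point (c k) \<in> ?A" and B: "vertex_point (c' m) \<in> ?B"
    using vertex_point_path_points c c' by auto
  have ge: "real N \<le> rdist T a b" if ab: "a \<in> ?A" "b \<in> ?B" for a b
  proof (rule rdist_ge)
    show "a \<in> realization T" "b \<in> realization T" using that by (auto simp: path_points_def)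
    fix u w assume uw: "u \<in> supp a" "w \<in> supp b"
    obtain i where "u = c i" using uw ab by (auto simp: path_points_def)
    moreover obtain j where "w = c' j" using uw ab by (auto simp: path_points_def)
    ultimately show "N \<le> gdist T u w" using Nle by simp
  qed
  have ge': "real N \<le> rdist_point_set T a ?B" if "a \<in> ?A" for a
    unfolding rdist_point_set_def using B ge[OF that] by (intro cINF_greatest) auto
  have "rdist_point_set T (vertex_point (c k)) ?B \<le> rdist T (vertex_point (c k)) (vertex_point (c' m))"
    unfolding rdist_point_set_def using B ge[OF A] by (intro cINF_lower bdd_belowI2) auto
  also have "\<dots> = real N" using rdist_vertex_points lineD(1)[OF c] lineD(1)[OF c'] by (simp add: N_def)
  finally have 1: "rdist_point_set T (vertex_point (c k)) ?B = real N" using ge'[OF A] by simp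
  have "rdist_sets T ?A ?B \<le> rdist_point_set T (vertex_point (c k)) ?B"
    unfolding rdist_sets_def using A ge' by (intro cINF_lower bdd_belowI2) auto
  moreover have "real N \<le> rdist_sets T ?A ?B"
    unfolding rdist_sets_def using A ge' by (intro cINF_greatest) auto
  ultimately show ?thesis using 1 A by (simp add: Proj_def)
qed

text \<open>The combinatorial content of the hypotheses of the Ping Pong Lemma: \<open>m i\<close> is the
  first integer of the window on the \<open>i\<close>-th axis.\<close>
lemma ping_pong_windows:
  assumes pp: "ping_pong_hypotheses T n X"
    and X: "\<And>i. i \<in> {1..n} \<Longrightarrow> X i \<in> carrier (Isom T) \<and> \<not> is_inversion T (X i)"
  obtains c m where "\<And>i. i \<in> {1..n} \<Longrightarrow> line (c i)"
    "\<And>i k. i \<in> {1..n} \<Longrightarrow> X i (c i k) = c i (k + int (tlen T (X i)))"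
    "\<And>i. i \<in> {1..n} \<Longrightarrow> tlen T (X i) > 0"
    "\<And>i j k. i \<in> {1..n} \<Longrightarrow> j \<in> {1..n} \<Longrightarrow> i \<noteq> j \<Longrightarrow> nearest (c i) (c j) k \<Longrightarrow>
       m i \<le> k \<and> k < m i + int (tlen T (X i))"
proof -
  have hyp: "hyperbolic T (X i)" if "i \<in> {1..n}" for i
    using that pp by (simp add: ping_pong_hypotheses_def)
  have "\<exists>c. line c \<and> (\<forall>k. X i (c k) = c (k + int (tlen T (X i))))" if "i \<in> {1..n}" for i
    using axis_exists[of "X i"] X[OF that] hyp[OF that] by metis
  then obtain c where c: "\<And>i. i \<in> {1..n} \<Longrightarrow> line (c i)"
    "\<And>i k. i \<in> {1..n} \<Longrightarrow> X i (c i k) = c i (k + int (tlen T (X i)))" by metis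
  have axis: "axis T (X i) = path_points T (c i)" if "i \<in> {1..n}" for i
    using axis_eq[OF c(1)[OF that] _ c(2)[OF that] hyp[OF that]] Isom_isometry X[OF that] by blast
  have "\<exists>m. \<forall>j k. j \<in> {1..n} \<longrightarrow> i \<noteq> j \<longrightarrow> nearest (c i) (c j) k \<longrightarrow>
       m \<le> k \<and> k < m + int (tlen T (X i))" if i: "i \<in> {1..n}" for i
  proof -
    obtain p q where pq: "p \<in> path_points T (c i)" "q \<in> path_points T (c i)"
      "rdist T p q = real (tlen T (X i))"
      "(\<Union>j\<in>{1..n} - {i}. Proj T (axis T (X i)) (axis T (X j))) \<subseteq> osegment T p q"
      using pp i axis[OF i] unfolding ping_pong_hypotheses_def by metis
    obtain m where m: "\<And>k. vertex_point (c i k) \<in> osegment T p q \<Longrightarrow> m \<le> k \<and> k < m + int (tlen T (X i))"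
      using osegment_window[OF c(1)[OF i] pq(1-3)] by blast
    have "vertex_point (c i k) \<in> osegment T p q"
      if "j \<in> {1..n}" "i \<noteq> j" "nearest (c i) (c j) k" for j k
    proof -
      have "vertex_point (c i k) \<in> Proj T (axis T (X i)) (axis T (X j))"
        using nearest_in_Proj[OF c(1)[OF i] c(1)[OF that(1)] that(3)] axis[OF i] axis[OF that(1)] by simp
      then show ?thesis using pq(4) that(1,2) by blast
    qed
    then show ?thesis using m by blast
  qed
  then obtain m where "\<And>i j k. i \<in> {1..n} \<Longrightarrow> j \<in> {1..n} \<Longrightarrow> i \<noteq> j \<Longrightarrow> nearest (c i) (c j) k \<Longrightarrow>
       m i \<le> k \<and> k < m i + int (tlen T (X i))" by metis
  moreover have "tlen T (X i) > 0" if "i \<in> {1..n}" for i using hyp[OF that] by (simp add: hyperbolic_def)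
  ultimately show ?thesis using that c by blast
qed

end

section \<open>Reduced words and ping-pong\<close>

definition letter :: "('g, 'm) monoid_scheme \<Rightarrow> bool \<times> 'g \<Rightarrow> 'g" where
  "letter H a = (if fst a then snd a else inv\<^bsub>H\<^esub> (snd a))"

definition inv_letter :: "bool \<times> 'g \<Rightarrow> bool \<times> 'g" where
  "inv_letter a = (\<not> fst a, snd a)"

lemma inv_letter_simps [simp]: "inv_letter (inv_letter a) = a" "snd (inv_letter a) = snd a" "inv_letter a \<noteq> a" "a \<noteq> inv_letter a"
  by (auto simp: inv_letter_def prod_eq_iff)

lemma reduced_words_iff:
  fixes S :: "'g set"
  shows "w \<in> reduced_words S \<longleftrightarrow> snd ` set w \<subseteq> S \<and> successively (\<lambda>a b. b \<noteq> inv_letter a) w"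
proof -
  have "(\<lambda>x y. \<not> (snd x = snd y \<and> fst x \<noteq> fst (y :: bool \<times> 'g))) = (\<lambda>a b. b \<noteq> inv_letter a)"
    by (auto simp: inv_letter_def fun_eq_iff prod_eq_iff)
  then show ?thesis unfolding reduced_words_def by (simp only: mem_Collect_eq)
qed

lemma eval_word_Nil [simp]: "eval_word H [] = \<one>\<^bsub>H\<^esub>"
  by (simp add: eval_word_def)

lemma eval_word_Cons [simp]: "eval_word H (a # w) = letter H a \<otimes>\<^bsub>H\<^esub> eval_word H w"
  by (simp add: eval_word_def letter_def case_prod_beta)

lemma reduced_words_Cons:
  "a # w \<in> reduced_words S \<longleftrightarrow>
     snd a \<in> S \<and> w \<in> reduced_words S \<and> (w = [] \<or> hd w \<noteq> inv_letter a)"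
  by (auto simp: reduced_words_iff successively_Cons)

context group
begin

lemma letter_closed: "snd a \<in> carrier G \<Longrightarrow> letter G a \<in> carrier G"
  by (simp add: letter_def)

lemma letter_inv_letter: "snd a \<in> carrier G \<Longrightarrow> letter G (inv_letter a) = inv (letter G a)"
  by (simp add: letter_def inv_letter_def)

lemma eval_word_closed: "snd ` set w \<subseteq> carrier G \<Longrightarrow> eval_word G w \<in> carrier G"
  by (induction w) (auto intro!: m_closed letter_closed)

lemma eval_word_append:
  assumes "snd ` set u \<subseteq> carrier G" "snd ` set v \<subseteq> carrier G"
  shows "eval_word G (u @ v) = eval_word G u \<otimes> eval_word G v"
  using assms(1)
  by (induction u) (auto simp: m_assoc letter_closed eval_word_closed assms(2))

lemma eval_word_replicate:
  assumes "snd ` set w \<subseteq> carrier G"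
  shows "eval_word G (concat (replicate n w)) = eval_word G w [^] n"
proof (induction n)
  case (Suc n)
  have "snd ` set (concat (replicate n w)) \<subseteq> carrier G" using assms by (induction n) auto
  then have "eval_word G (concat (replicate (Suc n) w)) = eval_word G w \<otimes> eval_word G w [^] n"
    using eval_word_append[OF assms] Suc by simp
  also have "\<dots> = eval_word G w [^] Suc n"
    using nat_pow_Suc2[OF eval_word_closed[OF assms], of n] by simp
  finally show ?case .
qed simp

lemma conjugate_pow:
  assumes "a \<in> carrier G" "x \<in> carrier G"
  shows "(a \<otimes> x \<otimes> inv a) [^] (n :: nat) = a \<otimes> x [^] n \<otimes> inv a"
proof (induction n)
  case (Suc n)
  have "inv a \<otimes> (a \<otimes> (x \<otimes> inv a)) = x \<otimes> inv a"
    using assms by (simp add: m_assoc[symmetric])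
  then have "(a \<otimes> x [^] n \<otimes> inv a) \<otimes> (a \<otimes> x \<otimes> inv a) = a \<otimes> (x [^] n \<otimes> x) \<otimes> inv a"
    using assms by (simp add: m_assoc)
  then show ?case using Suc by simp
qed (use assms in simp)

lemma reduced_replicate:
  assumes w: "w \<in> reduced_words S" "w \<noteq> []" and cyc: "hd w \<noteq> inv_letter (last w)"
  shows "concat (replicate n w) \<in> reduced_words S"
proof (induction n)
  case (Suc n)
  have "hd (concat (replicate n w)) = hd w" if "concat (replicate n w) \<noteq> []"
    using that w(2) by (cases n) auto
  then show ?case using Suc w cyc by (auto simp: reduced_words_iff successively_append_iff)
qed (simp add: reduced_words_iff)

text \<open>A cyclically reduced word has reduced powers, which are non-empty and hence not
  trivial in the group. A word that is not cyclically reduced has the form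
  \<open>a # u @ [inv_letter a]\<close>, so its value is conjugate to that of the shorter reduced word
  \<open>u\<close>.\<close>
lemma reduced_word_pow_ne_one:
  assumes inj: "inj_on (eval_word G) (reduced_words S)" and S: "S \<subseteq> carrier G"
    and w: "w \<in> reduced_words S" "w \<noteq> []" and n: "n > 0"
  shows "eval_word G w [^] (n :: nat) \<noteq> \<one>"
  using w
proof (induction w rule: length_induct)
  case (1 w)
  have sw: "snd ` set w \<subseteq> carrier G" using 1 S by (auto simp: reduced_words_iff)
  show ?case
  proof (cases "hd w = inv_letter (last w)")
    case False
    let ?u = "concat (replicate n w)"
    have "?u \<in> reduced_words S" using reduced_replicate 1 False by blast
    moreover have "[] \<in> reduced_words S" by (simp add: reduced_words_iff)
    moreover have "?u \<noteq> []" using n 1 by auto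
    ultimately have "eval_word G ?u \<noteq> eval_word G []" using inj_onD[OF inj, of ?u "[]"] by blast
    then show ?thesis using eval_word_replicate[OF sw] by simp
  next
    case True
    obtain a v where v: "w = a # v" using 1 by (cases w) auto
    have "v \<noteq> []" using True v by auto
    then obtain u where u: "v = u @ [inv_letter a]" using True v by (metis append_butlast_last_id inv_letter_simps(1) last_ConsR list.sel(1))
    have "u \<noteq> []" using 1 by (auto simp: v u reduced_words_iff)
    moreover have ur: "u \<in> reduced_words S"
      using 1 by (auto simp: v u reduced_words_iff successively_append_iff successively_Cons)
    ultimately have ne: "eval_word G u [^] n \<noteq> \<one>" using 1 by (simp add: v u)
    have a: "letter G a \<in> carrier G" and us: "snd ` set u \<subseteq> carrier G" and sa: "snd a \<in> carrier G"
      using sw by (auto simp: v u letter_closed)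
    note U = eval_word_closed[OF us]
    have "eval_word G w = letter G a \<otimes> eval_word G u \<otimes> inv (letter G a)"
      using a U us sa by (simp add: v u eval_word_append letter_inv_letter m_assoc)
    then have "eval_word G w [^] n = letter G a \<otimes> eval_word G u [^] n \<otimes> inv (letter G a)"
      using conjugate_pow[OF a U] by simp
    moreover have "eval_word G u [^] n = \<one>"
      if "letter G a \<otimes> eval_word G u [^] n \<otimes> inv (letter G a) = \<one>"
    proof -
      have "letter G a \<otimes> eval_word G u [^] n = letter G a"
        using that a U inv_equality[of "letter G a \<otimes> eval_word G u [^] n" "inv (letter G a)"] by simp
      then show ?thesis using a U r_cancel_one' l_cancel_one[of "letter G a"] by simp
    qed
    ultimately show ?thesis using ne by metis
  qed
qed

lemma free_group_torsion_free:
  assumes "free_group G" "g \<in> carrier G" "g [^] (n :: nat) = \<one>" "n > 0"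
  shows "g = \<one>"
proof -
  obtain S where S: "S \<subseteq> carrier G" "bij_betw (eval_word G) (reduced_words S) (carrier G)"
    using assms(1) by (auto simp: free_group_def)
  then obtain w where w: "w \<in> reduced_words S" "g = eval_word G w"
    using assms(2) by (auto simp: bij_betw_def)
  then have "w = []" using reduced_word_pow_ne_one[OF _ S(1)] S(2) assms by (auto simp: bij_betw_def)
  then show ?thesis using w by simp
qed

text \<open>Every generated element is the value of some word. Prefixing a letter to a reduced
  word either keeps it reduced or cancels its first letter.\<close>
lemma reduced_words_surj:
  assumes S: "S \<subseteq> carrier G" and g: "g \<in> generate G S"
  shows "\<exists>w\<in>reduced_words S. eval_word G w = g"
proof -
  have reduce: "\<exists>w\<in>reduced_words S. eval_word G w = eval_word G u" if "snd ` set u \<subseteq> S" for u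
    using that
  proof (induction u)
    case Nil
    then show ?case by (intro bexI[of _ "[]"]) (auto simp: reduced_words_iff)
  next
    case (Cons a u)
    then obtain w where w: "w \<in> reduced_words S" "eval_word G w = eval_word G u" by auto
    have a: "snd a \<in> S" using Cons by simp
    show ?case
    proof (cases "w \<noteq> [] \<and> hd w = inv_letter a")
      case False
      then have "a # w \<in> reduced_words S" using a w by (auto simp: reduced_words_Cons)
      then show ?thesis using w by force
    next
      case True
      then obtain v where v: "w = inv_letter a # v" by (cases w) auto
      have vr: "v \<in> reduced_words S" using w v by (simp add: reduced_words_Cons)
      then have V: "eval_word G v \<in> carrier G"
        using S by (intro eval_word_closed) (auto simp: reduced_words_iff)
      have "letter G a \<in> carrier G" using a S letter_closed[of a] by blast
      then have "letter G a \<otimes> eval_word G u = eval_word G v"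
        using w(2) V a S unfolding v by (simp add: letter_inv_letter m_assoc[symmetric] subset_iff)
          (metis V letter_inv_letter r_inv l_one m_assoc inv_closed)
      then show ?thesis using vr by auto
    qed
  qed
  have "\<exists>u. snd ` set u \<subseteq> S \<and> eval_word G u = g"
    using g
  proof (induction rule: generate.induct)
    case one
    then show ?case by (intro exI[of _ "[]"]) simp
  next
    case (incl h)
    then show ?case using S by (intro exI[of _ "[(True, h)]"]) (auto simp: letter_def)
  next
    case (inv h)
    then show ?case using S by (intro exI[of _ "[(False, h)]"]) (auto simp: letter_def)
  next
    case (eng h1 h2)
    then obtain u v where "snd ` set u \<subseteq> S" "eval_word G u = h1" "snd ` set v \<subseteq> S" "eval_word G v = h2"
      by auto
    then show ?case using S eval_word_append[of u v] by (intro exI[of _ "u @ v"]) auto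
  qed
  then show ?thesis using reduce by metis
qed

text \<open>The element of a reduced word sends a point outside \<open>U (inv_letter b)\<close>, where \<open>b\<close> is
  the last letter, into \<open>U a\<close>, where \<open>a\<close> is the first letter. Two reduced words with different
  first letters therefore have different values, provided that one point is suitable for both
  last letters; the same argument, with a point outside \<open>U a\<close>, separates a non-empty word from
  the empty one. Common first letters are cancelled.\<close>
proposition ping_pong:
  assumes S: "S \<subseteq> carrier G" "generate G S = carrier G"
    and act_closed: "\<And>g x. g \<in> carrier G \<Longrightarrow> x \<in> V \<Longrightarrow> act g x \<in> V"
    and act_mult: "\<And>g h x. g \<in> carrier G \<Longrightarrow> h \<in> carrier G \<Longrightarrow> x \<in> V \<Longrightarrow> act (g \<otimes> h) x = act g (act h x)"
    and act_one: "\<And>x. x \<in> V \<Longrightarrow> act \<one> x = x"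
    and disj: "\<And>a b. snd a \<in> S \<Longrightarrow> snd b \<in> S \<Longrightarrow> a \<noteq> b \<Longrightarrow> V \<inter> U a \<inter> U b = {}"
    and step: "\<And>a x. snd a \<in> S \<Longrightarrow> x \<in> V \<Longrightarrow> x \<notin> U (inv_letter a) \<Longrightarrow> act (letter G a) x \<in> U a"
    and spare: "\<And>a. snd a \<in> S \<Longrightarrow> \<exists>x\<in>V. x \<notin> U a \<and> x \<notin> U (inv_letter a)"
  shows "bij_betw (eval_word G) (reduced_words S) (carrier G)"
proof -
  have closed: "w \<in> reduced_words S \<Longrightarrow> eval_word G w \<in> carrier G" for w
    using S(1) by (intro eval_word_closed) (auto simp: reduced_words_iff)
  have lclosed: "snd a \<in> S \<Longrightarrow> letter G a \<in> carrier G" for a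
    using S(1) letter_closed[of a] by blast
  \<comment> \<open>For letters of different generators, a point of \<open>U (inv_letter a)\<close> avoids both
    sets by disjointness, and \<open>step\<close> provides such a point.\<close>
  have avoid: "\<exists>x\<in>V. x \<notin> U a \<and> x \<notin> U b" if ab: "snd a \<in> S" "snd b \<in> S" for a b
  proof (cases "snd a = snd b")
    case True
    then have "b = a \<or> b = inv_letter a" by (auto simp: inv_letter_def prod_eq_iff)
    then show ?thesis using spare[OF ab(1)] by blast
  next
    case False
    obtain x where x: "x \<in> V" "x \<notin> U a" using spare[OF ab(1)] by blast
    let ?y = "act (letter G (inv_letter a)) x"
    have y: "?y \<in> U (inv_letter a)" "?y \<in> V"
      using step[of "inv_letter a" x] x ab act_closed lclosed[of "inv_letter a"] by auto
    moreover have "inv_letter a \<noteq> b" using False by auto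
    ultimately show ?thesis using disj[of "inv_letter a" a] disj[of "inv_letter a" b] ab by force
  qed
  have word: "act (eval_word G w) x \<in> U (hd w)"
    if "w \<in> reduced_words S" "w \<noteq> []" "x \<in> V" "x \<notin> U (inv_letter (last w))" for w x
    using that
  proof (induction w)
    case (Cons a w)
    have a: "snd a \<in> S" and w: "w \<in> reduced_words S" using Cons.prems by (auto simp: reduced_words_Cons)
    have "act (eval_word G w) x \<notin> U (inv_letter a)"
    proof (cases "w = []")
      case True
      then show ?thesis using Cons.prems act_one by simp
    next
      case False
      then have "act (eval_word G w) x \<in> U (hd w)" using Cons by (simp add: reduced_words_Cons)
      moreover have "hd w \<noteq> inv_letter a" using Cons.prems(1) False by (simp add: reduced_words_Cons)
      moreover have "snd (hd w) \<in> S" using w False by (auto simp: reduced_words_iff)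
      ultimately show ?thesis
        using disj[of "hd w" "inv_letter a"] a act_closed[OF closed[OF w] Cons.prems(3)] by auto
    qed
    then have "act (letter G a) (act (eval_word G w) x) \<in> U a"
      using step[OF a] act_closed[OF closed[OF w] Cons.prems(3)] by blast
    then show ?case using act_mult[OF lclosed[OF a] closed[OF w] Cons.prems(3)] by simp
  qed simp
  have sl: "snd (hd w) \<in> S" "snd (inv_letter (last w)) \<in> S" if "w \<in> reduced_words S" "w \<noteq> []" for w
    using that by (auto simp: reduced_words_iff)
  have nontriv: "eval_word G w \<noteq> \<one>" if w: "w \<in> reduced_words S" "w \<noteq> []" for w
  proof
    assume 1: "eval_word G w = \<one>"
    obtain x where x: "x \<in> V" "x \<notin> U (inv_letter (last w))" "x \<notin> U (hd w)"
      using avoid[OF sl(2)[OF w] sl(1)[OF w]] by blast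
    then show False using word[OF w x(1,2)] act_one 1 by simp
  qed
  have "u = v" if "u \<in> reduced_words S" "v \<in> reduced_words S" "eval_word G u = eval_word G v" for u v
    using that
  proof (induction u arbitrary: v)
    case Nil
    then show ?case using nontriv[of v] by auto
  next
    case (Cons a u)
    obtain b v' where v: "v = b # v'" using Cons.prems nontriv[of "a # u"] by (cases v) auto
    have au: "snd a \<in> S" "u \<in> reduced_words S" and bv: "snd b \<in> S" "v' \<in> reduced_words S"
      using Cons.prems v by (auto simp: reduced_words_Cons)
    show ?case
    proof (cases "a = b")
      case True
      then have "eval_word G u = eval_word G v'"
        using Cons.prems(3) lclosed[OF au(1)] closed au bv by (simp add: v)
      then show ?thesis using Cons.IH au bv True v by simp
    next
      case False
      have ne: "a # u \<noteq> []" "v \<noteq> []" using v by auto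
      obtain x where x: "x \<in> V" "x \<notin> U (inv_letter (last (a # u)))" "x \<notin> U (inv_letter (last v))"
        using avoid[OF sl(2)[OF Cons.prems(1) ne(1)] sl(2)[OF Cons.prems(2) ne(2)]] by blast
      have "act (eval_word G (a # u)) x \<in> U a" "act (eval_word G v) x \<in> U b"
        using word[OF Cons.prems(1) ne(1) x(1,2)] word[OF Cons.prems(2) ne(2) x(1,3)] v by auto
      moreover have "act (eval_word G v) x \<in> V" using act_closed closed Cons.prems(2) x(1) by blast
      ultimately show ?thesis using disj[OF au(1) bv(1) False] Cons.prems(3) by auto
    qed
  qed
  then have "inj_on (eval_word G) (reduced_words S)" by (auto intro: inj_onI)
  moreover have "eval_word G ` reduced_words S = carrier G"
    using closed reduced_words_surj[OF S(1)] S(2) by (auto simp: image_iff)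
  ultimately show ?thesis by (simp add: bij_betw_def)
qed

end

section \<open>Ping-pong for hyperbolic isometries\<close>

context tree
begin

proposition free_if_ping_pong:
  assumes G: "subgroup G (Isom T)" and X: "\<And>i. i \<in> {1..n} \<Longrightarrow> X i \<in> G"
    and gen: "generate (Isom T) (X ` {1..n}) = G"
    and noinv: "acts_without_inversions T G" and pp: "ping_pong_hypotheses T n X"
  shows "free_group (Isom T\<lparr>carrier := G\<rparr>)"
proof -
  interpret I: group "Isom T" by (rule Isom_group)
  let ?H = "Isom T\<lparr>carrier := G\<rparr>"
  interpret H: group ?H using G by (rule I.subgroup_imp_group)
  have GI: "G \<subseteq> carrier (Isom T)" using G by (rule subgroup.subset)
  let ?S = "X ` {1..n}"
  have SG: "?S \<subseteq> G" using X by auto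
  have car: "X i \<in> carrier (Isom T) \<and> \<not> is_inversion T (X i)" if "i \<in> {1..n}" for i
    using X[OF that] GI noinv by (auto simp: acts_without_inversions_def)
  show ?thesis
  proof (rule ping_pong_windows[OF pp car])
    fix c :: "nat \<Rightarrow> int \<Rightarrow> 'a" and m :: "nat \<Rightarrow> int"
    assume c: "\<And>i. i \<in> {1..n} \<Longrightarrow> line (c i)"
      and tr: "\<And>i k. i \<in> {1..n} \<Longrightarrow> X i (c i k) = c i (k + int (tlen T (X i)))"
      and l: "\<And>i. i \<in> {1..n} \<Longrightarrow> tlen T (X i) > 0"
      and win: "\<And>i j k. i \<in> {1..n} \<Longrightarrow> j \<in> {1..n} \<Longrightarrow> i \<noteq> j \<Longrightarrow> nearest (c i) (c j) k \<Longrightarrow>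
         m i \<le> k \<and> k < m i + int (tlen T (X i))"
    \<comment> \<open>Words are spelled with the isometries themselves rather than with indices, so
      each generator is assigned one of its indices.\<close>
    define ix where "ix = inv_into {1..n} X"
    have ix: "ix s \<in> {1..n}" "X (ix s) = s" if "s \<in> ?S" for s
      unfolding ix_def using inv_into_into[OF that] f_inv_into_f[OF that] by blast+
    define p where "p s v = pos (c (ix s)) v" for s v
    define U where "U a = (if fst a then {v. m (ix (snd a)) + int (tlen T (snd a)) \<le> p (snd a) v}
        else {v. p (snd a) v < m (ix (snd a))})" for a
    have "bij_betw (eval_word ?H) (reduced_words ?S) (carrier ?H)"
    proof (rule H.ping_pong[where V = V and U = U and act = "\<lambda>g x. g x"])
      show "?S \<subseteq> carrier ?H" using SG by simp
      show "generate ?H ?S = carrier ?H" using I.generate_consistent[OF SG G] gen by simp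
    next
      fix g x assume "g \<in> carrier ?H" "x \<in> V"
      then show "g x \<in> V" using isometryD(1)[OF Isom_isometry] GI by auto
    next
      fix g h x assume "g \<in> carrier ?H" "h \<in> carrier ?H" "x \<in> V"
      then show "(g \<otimes>\<^bsub>?H\<^esub> h) x = g (h x)" using Isom_mult_apply GI by auto
    next
      fix x assume "x \<in> V"
      then show "\<one>\<^bsub>?H\<^esub> x = x" using Isom_one_apply by simp
    next
      fix a b :: "bool \<times> ('a \<Rightarrow> 'a)"
      assume a: "snd a \<in> ?S" and b: "snd b \<in> ?S" and ab: "a \<noteq> b"
      note ia = ix[OF a] and ib = ix[OF b]
      show "V \<inter> U a \<inter> U b = {}"
      proof (cases "snd a = snd b")
        case True
        then have "fst a \<noteq> fst b" using ab by (simp add: prod_eq_iff)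
        then show ?thesis using True by (auto simp: U_def)
      next
        case False
        then have ne: "ix (snd a) \<noteq> ix (snd b)" using ia ib by metis
        have "False" if v: "v \<in> V" "v \<in> U a" "v \<in> U b" for v
        proof -
          have out: "\<not> (m (ix (snd e)) \<le> p (snd e) v \<and> p (snd e) v < m (ix (snd e)) + int (tlen T (snd e)))"
            if "v \<in> U e" for e using that by (auto simp: U_def split: if_splits)
          from projections_nearest[OF c[OF ia(1)] c[OF ib(1)] v(1)] show False
            using win[OF ia(1) ib(1) ne] win[OF ib(1) ia(1) ne[symmetric]] out[OF v(2)] out[OF v(3)] ia(2) ib(2)
            unfolding p_def by metis
        qed
        then show ?thesis by blast
      qed
    next
      fix a :: "bool \<times> ('a \<Rightarrow> 'a)" and x assume a: "snd a \<in> ?S" and x: "x \<in> V" "x \<notin> U (inv_letter a)"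
      note ia = ix[OF a]
      let ?s = "snd a" and ?l = "int (tlen T (snd a))"
      have s: "?s \<in> carrier (Isom T)" "?s \<in> G" using a SG GI by auto
      have trs: "?s (c (ix ?s) k) = c (ix ?s) (k + ?l)" for k using tr[OF ia(1)] ia(2) by simp
      have inv: "inv\<^bsub>?H\<^esub> ?s = inv\<^bsub>Isom T\<^esub> ?s" using I.m_inv_consistent[OF G s(2)] .
      show "letter ?H a x \<in> U a"
      proof (cases "fst a")
        case True
        have "p ?s (?s x) = p ?s x + ?l"
          unfolding p_def using pos_translate[OF c[OF ia(1)] Isom_isometry[OF s(1)] trs x(1)] .
        then show ?thesis using True x(2) by (simp add: letter_def U_def inv_letter_def)
      next
        case False
        have "(inv\<^bsub>Isom T\<^esub> ?s) (c (ix ?s) k) = c (ix ?s) (k + (- ?l))" for k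
          using trs[of "k - ?l"] Isom_inv_apply(1)[OF s(1) lineD(1)[OF c[OF ia(1)]], of "k - ?l"] by simp
        then have "p ?s ((inv\<^bsub>Isom T\<^esub> ?s) x) = p ?s x + (- ?l)"
          unfolding p_def using pos_translate[OF c[OF ia(1)] Isom_isometry[OF I.inv_closed[OF s(1)]] _ x(1)] by blast
        then show ?thesis using False x(2) inv by (simp add: letter_def U_def inv_letter_def)
      qed
    next
      fix a :: "bool \<times> ('a \<Rightarrow> 'a)" assume a: "snd a \<in> ?S"
      note ia = ix[OF a]
      have "c (ix (snd a)) (m (ix (snd a))) \<in> V" using lineD(1)[OF c[OF ia(1)]] .
      moreover have "p (snd a) (c (ix (snd a)) (m (ix (snd a)))) = m (ix (snd a))"
        unfolding p_def using pos_line[OF c[OF ia(1)]] .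
      ultimately show "\<exists>x\<in>V. x \<notin> U a \<and> x \<notin> U (inv_letter a)"
        using l[OF ia(1)] ia(2) by (intro bexI[of _ "c (ix (snd a)) (m (ix (snd a)))"]) (auto simp: U_def inv_letter_def)
    qed
    then show "free_group ?H" using SG by (auto simp: free_group_def)
  qed
qed

end

section \<open>Minimal generating tuples\<close>

context tree
begin

lemma tuple_move_in_subgroup:
  assumes G: "subgroup G (Isom T)" and X: "\<And>i. i \<in> I \<Longrightarrow> X i \<in> G" and j: "j \<in> I"
  shows "i \<in> I \<Longrightarrow> tuple_move T j S1 S2 X i \<in> G"
  using X j subgroup.m_closed[OF G] subgroup.m_inv_closed[OF G] by (auto simp: tuple_move_def)

text \<open>A move keeps \<open>X j\<close> and multiplies the other entries by powers of it, so it can be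
  undone inside the subgroup that the new tuple generates.\<close>
lemma tuple_move_generates:
  assumes G: "subgroup G (Isom T)" and X: "\<And>i. i \<in> I \<Longrightarrow> X i \<in> G" and j: "j \<in> I"
    and gen: "generate (Isom T) (X ` I) = G"
  shows "generate (Isom T) (tuple_move T j S1 S2 X ` I) = G"
proof -
  interpret I: group "Isom T" by (rule Isom_group)
  let ?Y = "tuple_move T j S1 S2 X"
  have YG: "?Y ` I \<subseteq> G" using tuple_move_in_subgroup[OF G, of I X j] X j by blast
  have GI: "G \<subseteq> carrier (Isom T)" using G by (rule subgroup.subset)
  let ?E = "generate (Isom T) (?Y ` I)"
  have E: "subgroup ?E (Isom T)" using YG GI by (intro I.generate_is_subgroup) auto
  have Y: "?Y i \<in> ?E" if "i \<in> I" for i using that by (intro generate.incl) auto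
  have xj: "X j \<in> ?E" using Y[OF j] by (simp add: tuple_move_def)
  note closed = subgroup.m_closed[OF E] subgroup.m_inv_closed[OF E]
  have "X i \<in> ?E" if i: "i \<in> I" for i
  proof -
    have car: "X i \<in> carrier (Isom T)" "X j \<in> carrier (Isom T)" using X i j GI by auto
    define x where "x = X i"
    define y where "y = X j"
    note xy = car[folded x_def y_def] and Yi = Y[OF i] and yE = xj[folded y_def]
    have 1: "x = inv\<^bsub>Isom T\<^esub> y \<otimes>\<^bsub>Isom T\<^esub> (y \<otimes>\<^bsub>Isom T\<^esub> x)"
      using xy by (simp add: I.m_assoc[symmetric])
    have 2: "x = (x \<otimes>\<^bsub>Isom T\<^esub> inv\<^bsub>Isom T\<^esub> y) \<otimes>\<^bsub>Isom T\<^esub> y" using xy by (simp add: I.m_assoc)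
    have 3: "x = inv\<^bsub>Isom T\<^esub> y \<otimes>\<^bsub>Isom T\<^esub> (y \<otimes>\<^bsub>Isom T\<^esub> x \<otimes>\<^bsub>Isom T\<^esub> inv\<^bsub>Isom T\<^esub> y) \<otimes>\<^bsub>Isom T\<^esub> y"
    proof -
      have "inv\<^bsub>Isom T\<^esub> y \<otimes>\<^bsub>Isom T\<^esub> (y \<otimes>\<^bsub>Isom T\<^esub> (x \<otimes>\<^bsub>Isom T\<^esub> inv\<^bsub>Isom T\<^esub> y)) = x \<otimes>\<^bsub>Isom T\<^esub> inv\<^bsub>Isom T\<^esub> y"
        using xy by (simp add: I.m_assoc[symmetric])
      then show ?thesis using xy 2 by (simp add: I.m_assoc)
    qed
    have "?Y i = y \<otimes>\<^bsub>Isom T\<^esub> x \<or> ?Y i = x \<otimes>\<^bsub>Isom T\<^esub> inv\<^bsub>Isom T\<^esub> y \<or>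
        ?Y i = y \<otimes>\<^bsub>Isom T\<^esub> x \<otimes>\<^bsub>Isom T\<^esub> inv\<^bsub>Isom T\<^esub> y \<or> ?Y i = x"
      by (simp add: tuple_move_def x_def y_def)
    then show ?thesis using Yi yE closed 1 2 3 unfolding x_def[symmetric] by metis
  qed
  then have "generate (Isom T) (X ` I) \<subseteq> ?E" using E by (intro I.generate_subgroup_incl) auto
  moreover have "?E \<subseteq> G" using I.generate_subgroup_incl[OF YG G] .
  ultimately show ?thesis using gen by simp
qed

text \<open>Least length excludes trivial entries, and least \<^const>\<open>Lsum\<close> for this length
  gives minimality, because moves lead to generating tuples of the same length.\<close>
lemma minimal_generating_tuple:
  assumes G: "subgroup G (Isom T)" and fg: "fin_gen (Isom T\<lparr>carrier := G\<rparr>)"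
  obtains n X where "\<And>i. i \<in> {1..n} \<Longrightarrow> X i \<in> G" "generate (Isom T) (X ` {1..n}) = G"
    "minimal_tuple T n X" "\<And>i. i \<in> {1..n} \<Longrightarrow> X i \<noteq> \<one>\<^bsub>Isom T\<^esub>"
proof -
  interpret I: group "Isom T" by (rule Isom_group)
  define P where "P n X \<longleftrightarrow> (\<forall>i\<in>{1..n}. X i \<in> G) \<and> generate (Isom T) (X ` {1..n}) = G"
    for n :: nat and X
  have "\<exists>n X. P n X"
  proof -
    obtain S where S: "finite S" "S \<subseteq> G" "generate (Isom T\<lparr>carrier := G\<rparr>) S = G"
      using fg by (auto simp: fin_gen_def)
    obtain X where "bij_betw X {1..card S} S" using ex_bij_betw_nat_finite_1[OF S(1)] by blast
    then have X: "X ` {1..card S} = S" by (simp add: bij_betw_def)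
    then have "P (card S) X" unfolding P_def using S(2,3) I.generate_consistent[OF S(2) G] by auto
    then show ?thesis by blast
  qed
  define n where "n = (LEAST n. \<exists>X. P n X)"
  have "\<exists>X. P n X" unfolding n_def using \<open>\<exists>n X. P n X\<close> by (rule LeastI_ex)
  then obtain X where X: "P n X" and min: "\<And>Y. P n Y \<Longrightarrow> Lsum T n X \<le> Lsum T n Y"
    using ex_has_least_nat[of "P n" _ "Lsum T n"] by blast
  have "minimal_tuple T n X"
    unfolding minimal_tuple_def
  proof (intro ballI allI impI)
    fix j S1 S2 assume j: "j \<in> {1..n}"
    have "P n (tuple_move T j S1 S2 X)"
      using X tuple_move_generates[OF G _ j] tuple_move_in_subgroup[OF G _ j] unfolding P_def by blast
    then show "Lsum T n X \<le> Lsum T n (tuple_move T j S1 S2 X)" by (rule min)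
  qed
  moreover have "X i \<noteq> \<one>\<^bsub>Isom T\<^esub>" if i: "i \<in> {1..n}" for i
  proof
    assume 1: "X i = \<one>\<^bsub>Isom T\<^esub>"
    \<comment> \<open>The trivial entry is overwritten by the last one, which leaves a tuple of
      length \<open>n - 1\<close>.\<close>
    define Y where "Y = X(i := X n)"
    have YG: "Y ` {1..n - 1} \<subseteq> G" using X i by (auto simp: P_def Y_def)
    have GI: "G \<subseteq> carrier (Isom T)" using G by (rule subgroup.subset)
    let ?E = "generate (Isom T) (Y ` {1..n - 1})"
    have E: "subgroup ?E (Isom T)" using YG GI by (intro I.generate_is_subgroup) auto
    have "X k \<in> ?E" if k: "k \<in> {1..n}" for k
    proof (cases "k = i")
      case True
      then show ?thesis using 1 generate.one by metis
    next
      case False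
      have "X k \<in> Y ` {1..n - 1}"
      proof (cases "k = n")
        case True
        then have "X k = Y i" "i \<in> {1..n - 1}" using False i by (auto simp: Y_def)
        then show ?thesis by blast
      next
        case n: False
        then have "X k = Y k" "k \<in> {1..n - 1}" using False k by (auto simp: Y_def)
        then show ?thesis by blast
      qed
      then show ?thesis by (rule generate.incl)
    qed
    then have "generate (Isom T) (X ` {1..n}) \<subseteq> ?E" using E by (intro I.generate_subgroup_incl) auto
    moreover have "?E \<subseteq> G" using I.generate_subgroup_incl[OF YG G] .
    ultimately have "P (n - 1) Y" using X YG unfolding P_def by auto
    then have "n \<le> n - 1" unfolding n_def by (intro Least_le) blast
    then show False using i by simp
  qed
  ultimately show ?thesis using X that unfolding P_def by blast
qed

end

section \<open>Discrete subgroups\<close>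

context tree
begin

lemma vertex_topology_discrete:
  "Metric_space.mtopology V (\<lambda>x y. real (gdist T x y)) = discrete_topology V"
proof -
  interpret M: Metric_space V "\<lambda>x y. real (gdist T x y)"
  proof
    fix x y z
    show "0 \<le> real (gdist T x y)" by simp
    show "x \<in> V \<Longrightarrow> y \<in> V \<Longrightarrow> real (gdist T x y) = 0 \<longleftrightarrow> x = y" using gdist_eq_0 by simp
    show "x \<in> V \<Longrightarrow> y \<in> V \<Longrightarrow> z \<in> V \<Longrightarrow> real (gdist T x z) \<le> real (gdist T x y) + real (gdist T y z)"
      using gdist_triangle[of x y z] by linarith
    show "real (gdist T x y) = real (gdist T y x)" 
      using gdist_commute by simp
  qed
  have "openin M.mtopology {x}" if "x \<in> V" for x
  proof -
    have "M.mball x 1 \<subseteq> {x}" using gdist_eq_0 by auto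
    then show ?thesis using that unfolding M.openin_mtopology by (auto intro!: exI[of _ 1])
  qed
  then show ?thesis using discrete_topology_unique[of V M.mtopology] by simp
qed

text \<open>The vertices are discrete, so the sets of isometries with prescribed values on a
  finite set of vertices form a basis of the topology. By translation it suffices to isolate the
  identity.\<close>
lemma discrete_subgroup_iff:
  assumes G: "subgroup G (Isom T)"
  shows "discrete_subgroup T G \<longleftrightarrow>
    (\<exists>F. finite F \<and> F \<subseteq> V \<and> (\<forall>g\<in>G. (\<forall>v\<in>F. g v = v) \<longrightarrow> g = \<one>\<^bsub>Isom T\<^esub>))"
proof -
  interpret I: group "Isom T" by (rule Isom_group)
  let ?P = "product_topology (\<lambda>_. discrete_topology V) V"
  have GI: "G \<subseteq> carrier (Isom T)" using G by (rule subgroup.subset)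
  have GP: "G \<subseteq> V \<rightarrow>\<^sub>E V"
  proof
    fix g assume "g \<in> G"
    then have "bij_betw g V V" "g \<in> extensional V" using GI by (auto simp: Isom_carrier Bij_def)
    then show "g \<in> V \<rightarrow>\<^sub>E V" by (auto simp: PiE_iff dest: bij_betwE)
  qed
  have top: "subtopology (isom_topology T) G = subtopology ?P G"
    using GI by (simp add: isom_topology_def vertex_topology_discrete subtopology_subtopology Int_absorb1)
  have topspace: "topspace (subtopology ?P G) = G" using GP by (simp add: Int_absorb1)
  have one: "\<one>\<^bsub>Isom T\<^esub> \<in> G" using G by (rule subgroup.one_closed)
  show ?thesis
  proof
    assume "discrete_subgroup T G"
    then have "openin (subtopology ?P G) {\<one>\<^bsub>Isom T\<^esub>}"
      using one by (simp add: discrete_subgroup_def top)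
    then obtain W where W: "openin ?P W" "{\<one>\<^bsub>Isom T\<^esub>} = W \<inter> G" by (auto simp: openin_subtopology)
    then have "\<one>\<^bsub>Isom T\<^esub> \<in> W" by blast
    then obtain U where U: "finite {v \<in> V. U v \<noteq> V}" "\<one>\<^bsub>Isom T\<^esub> \<in> Pi\<^sub>E V U" "Pi\<^sub>E V U \<subseteq> W"
      using W(1) unfolding openin_product_topology_alt topspace_discrete_topology by blast
    have "g = \<one>\<^bsub>Isom T\<^esub>" if g: "g \<in> G" "\<forall>v\<in>{v \<in> V. U v \<noteq> V}. g v = v" for g
    proof -
      have "g v \<in> U v" if "v \<in> V" for v
      proof (cases "U v = V")
        case True
        then show ?thesis using GP g(1) PiE_mem[of g V "\<lambda>_. V" v] that by blast
      next
        case False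
        have "v \<in> U v" using PiE_mem[OF U(2) that] Isom_one_apply[OF that] by simp
        then show ?thesis using False that g(2) by simp
      qed
      then have "g \<in> Pi\<^sub>E V U" using GP g(1) by (intro PiE_I) (auto dest: PiE_arb)
      then show ?thesis using U(3) W(2) g(1) by blast
    qed
    moreover have "{v \<in> V. U v \<noteq> V} \<subseteq> V" by (rule Collect_restrict)
    ultimately show "\<exists>F. finite F \<and> F \<subseteq> V \<and> (\<forall>g\<in>G. (\<forall>v\<in>F. g v = v) \<longrightarrow> g = \<one>\<^bsub>Isom T\<^esub>)"
      using U(1) by (intro exI[of _ "{v \<in> V. U v \<noteq> V}"] conjI ballI impI)
  next
    assume "\<exists>F. finite F \<and> F \<subseteq> V \<and> (\<forall>g\<in>G. (\<forall>v\<in>F. g v = v) \<longrightarrow> g = \<one>\<^bsub>Isom T\<^esub>)"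
    then obtain F where F: "finite F" "F \<subseteq> V"
      "\<And>g. g \<in> G \<Longrightarrow> (\<And>v. v \<in> F \<Longrightarrow> g v = v) \<Longrightarrow> g = \<one>\<^bsub>Isom T\<^esub>" by auto
    have "openin (subtopology ?P G) {g}" if g: "g \<in> G" for g
    proof -
      let ?W = "PiE V (\<lambda>v. if v \<in> F then {g v} else V)"
      have gP: "g \<in> V \<rightarrow>\<^sub>E V" using GP g by blast
      have "{v \<in> V. (if v \<in> F then {g v} else V) \<noteq> V} \<subseteq> F" by auto
      then have "finite {v \<in> V. (if v \<in> F then {g v} else V) \<noteq> V}" using F(1) by (rule finite_subset)
      moreover have "\<forall>v\<in>V. (if v \<in> F then {g v} else V) \<subseteq> V" using PiE_mem[OF gP] by simp
      ultimately have "openin ?P ?W"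
        unfolding openin_PiE_gen topspace_discrete_topology openin_discrete_topology by blast
      moreover have "{g} = ?W \<inter> G"
      proof (intro equalityI subsetI)
        fix h assume "h \<in> {g}"
        then show "h \<in> ?W \<inter> G" using g gP PiE_mem[OF gP] by (auto intro!: PiE_I dest: PiE_arb)
      next
        fix h assume h: "h \<in> ?W \<inter> G"
        have gh: "g \<in> carrier (Isom T)" "h \<in> carrier (Isom T)" using g h GI by auto
        have k: "inv\<^bsub>Isom T\<^esub> g \<otimes>\<^bsub>Isom T\<^esub> h = \<one>\<^bsub>Isom T\<^esub>"
        proof (rule F(3))
          show "inv\<^bsub>Isom T\<^esub> g \<otimes>\<^bsub>Isom T\<^esub> h \<in> G"
            using g h subgroup.m_closed[OF G] subgroup.m_inv_closed[OF G] by blast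
          fix v assume v: "v \<in> F"
          then have vV: "v \<in> V" using F(2) by blast
          have "h v \<in> (if v \<in> F then {g v} else V)" using PiE_mem[OF IntD1[OF h] vV] .
          then have "h v = g v" using v by simp
          then show "(inv\<^bsub>Isom T\<^esub> g \<otimes>\<^bsub>Isom T\<^esub> h) v = v"
            using Isom_mult_apply[OF I.inv_closed[OF gh(1)] gh(2) vV] Isom_inv_apply(1)[OF gh(1) vV] by simp
        qed
        have "h = g"
          using I.inv_equality[OF k gh(2) I.inv_closed[OF gh(1)]] I.inv_inv[OF gh(1)]
            I.inv_inv[OF gh(2)] by metis
        then show "h \<in> {g}" by simp
      qed
      ultimately show ?thesis unfolding openin_subtopology by blast
    qed
    then show "discrete_subgroup T G"
      unfolding discrete_subgroup_def top
      using discrete_topology_unique[THEN iffD2, of "subtopology ?P G" G] topspace by simp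
  qed
qed

lemma finite_ball:
  assumes lf: "locally_finite_graph T" and x: "x \<in> V"
  shows "finite {v \<in> V. gdist T x v \<le> R}"
proof (induction R)
  case 0
  have "{v \<in> V. gdist T x v \<le> 0} \<subseteq> {x}" using gdist_eq_0[OF x] by auto
  then show ?case by (rule finite_subset) simp
next
  case (Suc R)
  let ?B = "{v \<in> V. gdist T x v \<le> R}"
  have nb: "finite {v. adj u v}" if "u \<in> V" for u
  proof -
    have "finite {e \<in> edges T. u \<in> e}" using lf that by (simp add: locally_finite_graph_def)
    moreover have "inj_on (\<lambda>v. {u, v}) {v. adj u v}" by (auto simp: inj_on_def doubleton_eq_iff)
    moreover have "(\<lambda>v. {u, v}) ` {v. adj u v} \<subseteq> {e \<in> edges T. u \<in> e}" by auto
    ultimately show ?thesis by (meson finite_subset finite_imageD)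
  qed
  have "{v \<in> V. gdist T x v \<le> Suc R} \<subseteq> ?B \<union> (\<Union>u\<in>?B. {v. adj u v})"
  proof
    fix v assume v: "v \<in> {v \<in> V. gdist T x v \<le> Suc R}"
    show "v \<in> ?B \<union> (\<Union>u\<in>?B. {v. adj u v})"
    proof (cases "gdist T x v = Suc R")
      case True
      then obtain u where "adj u v" "gdist T x u = R" using gdist_pred[OF x _ True] v by blast
      then show ?thesis using adjD(1)[of u v] by auto
    qed (use v in auto)
  qed
  then show ?case by (rule finite_subset) (use Suc nb in auto)
qed

text \<open>With \<open>x\<close> a fixed vertex of \<open>g\<close> and \<open>F\<close> a finite set whose pointwise stabilizer in
  \<open>G\<close> is trivial, the powers of \<open>g\<close> restrict to maps from \<open>F\<close> into a finite ball around \<open>x\<close>. Two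
  of them coincide, and their quotient fixes \<open>F\<close> pointwise.\<close>
lemma discrete_elliptic_torsion:
  assumes lf: "locally_finite_graph T" and G: "subgroup G (Isom T)" and disc: "discrete_subgroup T G"
    and g: "g \<in> G" and ell: "elliptic T g"
  shows "\<exists>n>0. g [^]\<^bsub>Isom T\<^esub> (n :: nat) = \<one>\<^bsub>Isom T\<^esub>"
proof -
  interpret I: group "Isom T" by (rule Isom_group)
  have gI: "g \<in> carrier (Isom T)" using g G subgroup.subset by blast
  define p where "p k = g [^]\<^bsub>Isom T\<^esub> (k :: nat)" for k
  have pI: "p k \<in> carrier (Isom T)" for k using gI by (simp add: p_def)
  have pG: "p k \<in> G" for k
    unfolding p_def by (induction k) (use g subgroup.one_closed[OF G] subgroup.m_closed[OF G] in auto)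
  note iso = isometryD[OF Isom_isometry[OF pI]]
  obtain x where x: "x \<in> V" "g x = x" using ell elliptic_iff_fixes_vertex[OF gI] by blast
  have px: "p k x = x" for k
  proof (induction k)
    case 0
    then show ?case using Isom_one_apply x by (simp add: p_def)
  next
    case (Suc k)
    have "p (Suc k) = p k \<otimes>\<^bsub>Isom T\<^esub> g" by (simp add: p_def)
    then show ?case using Suc Isom_mult_apply[OF pI gI x(1)] x(2) by simp
  qed
  obtain F where F: "finite F" "F \<subseteq> V"
    "\<And>g. g \<in> G \<Longrightarrow> (\<And>v. v \<in> F \<Longrightarrow> g v = v) \<Longrightarrow> g = \<one>\<^bsub>Isom T\<^esub>"
    using disc discrete_subgroup_iff[OF G] by auto
  define R where "R = Max (gdist T x ` F)"
  let ?B = "{v \<in> V. gdist T x v \<le> R}"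
  have "restrict (p k) F \<in> F \<rightarrow>\<^sub>E ?B" for k
  proof
    fix v assume v: "v \<in> F"
    then have vV: "v \<in> V" using F(2) by blast
    have "gdist T x (p k v) = gdist T x v" using iso(2)[OF x(1) vV, of k] px by simp
    also have "\<dots> \<le> R" unfolding R_def using F(1) v by simp
    finally show "restrict (p k) F v \<in> ?B" using iso(1)[OF vV] v by simp
  qed simp
  then have "range (\<lambda>k. restrict (p k) F) \<subseteq> F \<rightarrow>\<^sub>E ?B" by blast
  moreover have "finite (F \<rightarrow>\<^sub>E ?B)" using F(1) finite_ball[OF lf x(1)] by (intro finite_PiE) auto
  ultimately have "\<not> inj (\<lambda>k. restrict (p k) F)" using finite_subset range_inj_infinite by blast
  then obtain i j where ij: "i < j" "restrict (p i) F = restrict (p j) F"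
    unfolding inj_def by (metis linorder_neqE_nat)
  have "p (j - i) v = v" if v: "v \<in> F" for v
  proof -
    have vV: "v \<in> V" using v F(2) by blast
    have "p j = p i \<otimes>\<^bsub>Isom T\<^esub> p (j - i)"
      using I.nat_pow_mult[OF gI, of i "j - i"] ij(1) by (simp add: p_def)
    then have "p i (p (j - i) v) = p j v" using Isom_mult_apply[OF pI pI vV] by simp
    also have "\<dots> = p i v" using ij(2) v by (metis restrict_apply')
    finally have "gdist T (p (j - i) v) v = 0"
      using iso(2)[OF iso(1)[OF vV] vV, of i "j - i"] gdist_refl[OF iso(1)[OF vV]] by simp
    then show ?thesis using gdist_eq_0[OF iso(1)[OF vV] vV] by simp
  qed
  then have "p (j - i) = \<one>\<^bsub>Isom T\<^esub>" by (rule F(3)[OF pG])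
  then show ?thesis using ij(1) unfolding p_def by (intro exI[of _ "j - i"]) simp
qed

end

section \<open>Discrete free subgroups have no elliptic elements\<close>

theorem theorem2p6:
  fixes T :: "'a sgraph" and G :: "('a \<Rightarrow> 'a) set"
  assumes PP: "conjecture_PP TYPE('a)"
    and tree: "simplicial_tree T"
    and locally_finite: "locally_finite_graph T"
    and subgroup: "subgroup G (Isom T)"
    and fin_gen: "fin_gen (Isom T\<lparr>carrier := G\<rparr>)"
    and no_inversions: "acts_without_inversions T G"
  shows "discrete_subgroup T G \<and> free_group (Isom T\<lparr>carrier := G\<rparr>) \<longleftrightarrow>
         \<not> (\<exists>g\<in>G. g \<noteq> \<one>\<^bsub>Isom T\<^esub> \<and> elliptic T g)"
proof -
  interpret tree T using tree by unfold_locales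
  interpret I: group "Isom T" by (rule Isom_group)
  interpret H: group "Isom T\<lparr>carrier := G\<rparr>" using subgroup by (rule I.subgroup_imp_group)
  have GI: "G \<subseteq> carrier (Isom T)" using subgroup by (rule subgroup.subset)
  show ?thesis
  proof
    assume df: "discrete_subgroup T G \<and> free_group (Isom T\<lparr>carrier := G\<rparr>)"
    have "g = \<one>\<^bsub>Isom T\<^esub>" if g: "g \<in> G" "elliptic T g" for g
    proof -
      obtain n :: nat where n: "n > 0" "g [^]\<^bsub>Isom T\<^esub> n = \<one>\<^bsub>Isom T\<^esub>"
        using discrete_elliptic_torsion[OF locally_finite subgroup _ g] df by blast
      then show ?thesis
        using H.free_group_torsion_free[of g n] df g(1) I.nat_pow_consistent[of g n G] by simp
    qed
    then show "\<not> (\<exists>g\<in>G. g \<noteq> \<one>\<^bsub>Isom T\<^esub> \<and> elliptic T g)" by blast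
  next
    assume ne: "\<not> (\<exists>g\<in>G. g \<noteq> \<one>\<^bsub>Isom T\<^esub> \<and> elliptic T g)"
    obtain x where x: "x \<in> verts T" using tree by (auto simp: simplicial_tree_def)
    \<comment> \<open>A single vertex \<open>x\<close> suffices, since its stabilizer in \<open>G\<close> is trivial.\<close>
    have "discrete_subgroup T G"
      unfolding discrete_subgroup_iff[OF subgroup]
      using x ne elliptic_iff_fixes_vertex GI by (intro exI[of _ "{x}"]) auto
    moreover have "free_group (Isom T\<lparr>carrier := G\<rparr>)"
    proof -
      obtain n X where X: "\<And>i. i \<in> {1..n} \<Longrightarrow> X i \<in> G" "generate (Isom T) (X ` {1..n}) = G"
        "minimal_tuple T n X" "\<And>i. i \<in> {1..n} \<Longrightarrow> X i \<noteq> \<one>\<^bsub>Isom T\<^esub>"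
        using minimal_generating_tuple[OF subgroup fin_gen] by blast
      have "\<forall>i\<in>{1..n}. X i \<in> carrier (Isom T)" using X(1) GI by blast
      then have "(\<exists>i\<in>{1..n}. elliptic T (X i)) \<or> ping_pong_hypotheses T n X"
        using PP tree no_inversions X(2,3) unfolding conjecture_PP_def by blast
      then have "ping_pong_hypotheses T n X" using ne X(1,4) by blast
      then show ?thesis using free_if_ping_pong[OF subgroup X(1,2) no_inversions] by blast
    qed
    ultimately show "discrete_subgroup T G \<and> free_group (Isom T\<lparr>carrier := G\<rparr>)" ..
  qed
qed

end
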